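(* Let $k=\mathbb{R}$ or $k=\mathbb{F}_q$ with $q$ a power of an odd prime, let $K$ be the algebraic closure of $k$, and let $\Gamma=\mathrm{Gal}(K/k)$. Let $X=V(F)\subset\mathbb{P}^{n+1}_K$ be a smooth hypersurface of dimension $n\ge 1$ and degree $d\ge 3$ with $(n,d)\notin\{(1,3),(2,4)\}$, defined over $k$, such that all the monomials of $F$ have coefficient $1$. Assume that $\mathrm{Aut}(X)=D\rtimes P$, where $D$ is the (abelian) subgroup of diagonal automorphisms and $P\le S_{n+2}$ is the group of permutations of the variables preserving the set of monomials of $F$, embedded in $\mathrm{Aut}(X)$ by permutation matrices. Then $$|H^1(\Gamma,\mathrm{Aut}(X))|=\sum_{[c]\in H^1(\Gamma,P)}\big|H^1(\Gamma,{}_{c}D)/C_P(c)\big|,$$ where $C_P(c)$ denotes the centralizer of $c$ in $P$ and $H^1(\Gamma,{}_cD)/C_P(c)$ is the set of orbits of $C_P(c)$ acting on $H^1(\Gamma,{}_cD)$.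
   Context: $\mathrm{Aut}(X)$ is the group of $K$-automorphisms of $X$. $X$ defined over $k$ means $X=X'\times_{\mathrm{Spec}(k)}\mathrm{Spec}(K)$ for the hypersurface $X'$ over $k$ with the same equation $F$; $\Gamma$ acts on $\mathrm{Aut}(X)$ by ${}^{s}\varphi=(1\times s)\varphi(1\times s^{-1})$, i.e. on the matrix entries of linear automorphisms. $D$ consists of those automorphisms represented by a diagonal matrix in $\mathrm{GL}_{n+2}(K)$. The section $s\colon P\to\mathrm{Aut}(X)$ sends a permutation to the class of its permutation matrix; the induced action of $\Gamma$ on $P\cong\mathrm{Aut}(X)/D$ is trivial. For a profinite group $\Gamma$ and a discrete group $A$ with continuous $\Gamma$-action by automorphisms, a cocycle is a continuous map $a\colon\Gamma\to A$ with $a_{st}=a_s\,{}^sa_t$; two cocycles $a,a'$ are equivalent if $a'_s=b^{-1}a_s\,{}^sb$ for some $b\in A$; $H^1(\Gamma,A)$ is the set of equivalence classes. For a cocycle $c\in Z^1(\Gamma,P)$, ${}_cD$ denotes the group $D$ with twisted action $\gamma\ast\mu=s(c_\gamma)\,{}^{\gamma}\mu\,s(c_\gamma)^{-1}$. $C_P(c)$ is the set of $p\in P$ with $c_\gamma p c_\gamma^{-1}=p$ for all $\gamma\in\Gamma$, and $p\in C_P(c)$ acts on $H^1(\Gamma,{}_cD)$ by sending the class of $(\mu_\gamma)_\gamma$ to the class of $(s(p)^{-1}\mu_\gamma s(p))_\gamma$. *)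

theory Defs
  imports
    "HOL-Analysis.Analysis"
    "HOL-Algebra.Bij"
    "HOL-Algebra.Group_Action"
    "HOL-Algebra.Algebraic_Closure_Type"
    "HOL-Computational_Algebra.Primes"
    "HOL-Library.Poly_Mapping"
    "HOL-Library.Extended_Nat"
begin

definition ecard :: "'a set \<Rightarrow> enat" where
  "ecard S = (if finite S then enat (card S) else \<infinity>)"


section \<open>Polynomials and projective hypersurfaces\<close>

text \<open>A polynomial in the variables indexed by the finite type \<open>'v\<close> is a finitely supported map
  from exponent vectors to coefficients.\<close>

type_synonym ('v, 'a) mpol = "('v \<Rightarrow> nat) \<Rightarrow>\<^sub>0 'a"

definition mpol_eval :: "('v::finite, 'a::field) mpol \<Rightarrow> 'a ^ 'v \<Rightarrow> 'a" where
  "mpol_eval F x =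
    (\<Sum>m\<in>Poly_Mapping.keys F. Poly_Mapping.lookup F m * (\<Prod>i\<in>UNIV. (x $ i) ^ m i))"

text \<open>The value at \<open>x\<close> of the formal partial derivative with respect to the \<open>i\<close>-th variable;
  if \<open>m i = 0\<close>, the summand vanishes.\<close>

definition mpol_pderiv :: "'v::finite \<Rightarrow> ('v, 'a::field) mpol \<Rightarrow> 'a ^ 'v \<Rightarrow> 'a" where
  "mpol_pderiv i F x =
    (\<Sum>m\<in>Poly_Mapping.keys F. Poly_Mapping.lookup F m *
        (of_nat (m i) * (x $ i) ^ (m i - 1) * (\<Prod>j\<in>UNIV - {i}. (x $ j) ^ m j)))"

definition homogeneous :: "nat \<Rightarrow> ('v::finite, 'a::zero) mpol \<Rightarrow> bool" where
  "homogeneous d F \<longleftrightarrow> (\<forall>m\<in>Poly_Mapping.keys F. (\<Sum>i\<in>UNIV. m i) = d)"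

definition mpol_map :: "('v \<Rightarrow> ('v::finite, 'a::field) mpol) \<Rightarrow> 'a ^ 'v \<Rightarrow> 'a ^ 'v" where
  "mpol_map G x = (\<chi> i. mpol_eval (G i) x)"

definition base_change :: "('v, 'k::field) mpol \<Rightarrow> ('v, 'k alg_closure) mpol" where
  "base_change F = Poly_Mapping.map to_ac F"

text \<open>Points of projective space are the classes of nonzero vectors up to nonzero scalars.\<close>

definition proj_pt :: "'a::field ^ 'v \<Rightarrow> ('a ^ 'v) set" where
  "proj_pt x = {c *s x | c. c \<noteq> 0}"

definition hypersurface :: "('v::finite, 'a::field) mpol \<Rightarrow> ('a ^ 'v) set set" where
  "hypersurface F = {proj_pt x | x. x \<noteq> 0 \<and> mpol_eval F x = 0}"

definition smooth_hypersurface :: "('v::finite, 'a::field) mpol \<Rightarrow> bool" where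
  "smooth_hypersurface F \<longleftrightarrow>
    (\<forall>x. x \<noteq> 0 \<and> mpol_eval F x = 0 \<longrightarrow> (\<exists>i. mpol_pderiv i F x \<noteq> 0))"


section \<open>Automorphisms of a projective variety\<close>

text \<open>A map is regular if around every point it is given by homogeneous polynomials of one
  common degree. The neighbourhood may be taken to be the locus where these polynomials do not
  all vanish: a smaller principal open set \<open>H \<noteq> 0\<close> is obtained by multiplying all of them by \<open>H\<close>.\<close>

definition regular_map ::
    "('a::field ^ 'v::finite) set set \<Rightarrow> (('a ^ 'v) set \<Rightarrow> ('a ^ 'v) set) \<Rightarrow> bool" where
  "regular_map V \<phi> \<longleftrightarrow>
    (\<forall>p\<in>V. \<exists>e G. (\<forall>i. homogeneous e (G i)) \<and>
        (\<exists>x\<in>p. mpol_map G x \<noteq> 0) \<and>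
        (\<forall>q\<in>V. \<forall>y\<in>q. mpol_map G y \<noteq> 0 \<longrightarrow> \<phi> q = proj_pt (mpol_map G y)))"

text \<open>For an algebraically closed field and a reduced scheme \<open>V\<close>, the automorphisms of the
  scheme \<open>V\<close> over the field are the biregular maps of its set of closed points.\<close>

definition aut_group ::
    "('a::field ^ 'v::finite) set set \<Rightarrow> (('a ^ 'v) set \<Rightarrow> ('a ^ 'v) set) monoid" where
  "aut_group V = BijGroup V
    \<lparr>carrier := {\<phi> \<in> Bij V. regular_map V \<phi> \<and> regular_map V (\<lambda>p\<in>V. inv_into V \<phi> p)}\<rparr>"

definition linear_map ::
    "('a::field ^ 'v::finite) set set \<Rightarrow> 'a ^ 'v ^ 'v \<Rightarrow> ('a ^ 'v) set \<Rightarrow> ('a ^ 'v) set" where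
  "linear_map V M = (\<lambda>p\<in>V. (\<lambda>x. M *v x) ` p)"

definition diag_auts ::
    "('a::field ^ 'v::finite) set set \<Rightarrow> (('a ^ 'v) set \<Rightarrow> ('a ^ 'v) set) set" where
  "diag_auts V = {\<phi> \<in> carrier (aut_group V).
    \<exists>M. invertible M \<and> (\<forall>i j. i \<noteq> j \<longrightarrow> M $ i $ j = 0) \<and> \<phi> = linear_map V M}"

definition perm_matrix :: "('v \<Rightarrow> 'v) \<Rightarrow> 'a::field ^ 'v ^ 'v::finite" where
  "perm_matrix p = (\<chi> i j. if i = p j then 1 else 0)"

definition perm_aut ::
    "('a::field ^ 'v::finite) set set \<Rightarrow> ('v \<Rightarrow> 'v) \<Rightarrow> ('a ^ 'v) set \<Rightarrow> ('a ^ 'v) set" where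
  "perm_aut V p = linear_map V (perm_matrix p)"

text \<open>Substituting \<open>perm_matrix p *v x\<close> for \<open>x\<close> turns the monomial with exponents \<open>m\<close> into the one
  with exponents \<open>m \<circ> p\<close>.\<close>

definition perm_group :: "('v::finite, 'a::zero) mpol \<Rightarrow> ('v \<Rightarrow> 'v) monoid" where
  "perm_group F = BijGroup UNIV
    \<lparr>carrier := {p. bij p \<and> (\<lambda>m. m \<circ> p) ` Poly_Mapping.keys F = Poly_Mapping.keys F}\<rparr>"

text \<open>\<open>G\<close> is the semidirect product of its normal subgroup \<open>N\<close> and of \<open>H\<close>, embedded by \<open>s\<close>.\<close>

definition semidirect ::
    "('a, 'c) monoid_scheme \<Rightarrow> 'a set \<Rightarrow> ('b, 'd) monoid_scheme \<Rightarrow> ('b \<Rightarrow> 'a) \<Rightarrow> bool" where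
  "semidirect G N H s \<longleftrightarrow> N \<lhd> G \<and> s \<in> mon H G \<and>
    N \<inter> s ` carrier H = {\<one>\<^bsub>G\<^esub>} \<and> N <#>\<^bsub>G\<^esub> (s ` carrier H) = carrier G"


section \<open>The Galois group and its action\<close>

text \<open>In this section \<open>\<iota>\<close> is the embedding of the base field.\<close>

definition galois_group :: "('k::field \<Rightarrow> 'a::field) \<Rightarrow> ('a \<Rightarrow> 'a) monoid" where
  "galois_group \<iota> =
    \<lparr>carrier = {\<sigma>. bij \<sigma> \<and> (\<forall>x y. \<sigma> (x + y) = \<sigma> x + \<sigma> y) \<and> (\<forall>x y. \<sigma> (x * y) = \<sigma> x * \<sigma> y) \<and>
        (\<forall>a. \<sigma> (\<iota> a) = \<iota> a)},
     mult = (\<circ>), one = id\<rparr>"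

definition finite_subextension :: "('k::field \<Rightarrow> 'a::field) \<Rightarrow> 'a set \<Rightarrow> bool" where
  "finite_subextension \<iota> L \<longleftrightarrow>
    range \<iota> \<subseteq> L \<and> (\<forall>x\<in>L. \<forall>y\<in>L. x - y \<in> L \<and> x * y \<in> L \<and> inverse x \<in> L) \<and>
    (\<exists>B. finite B \<and> L = module.span (\<lambda>a x. \<iota> a * x) B)"

definition krull_topology :: "('k::field \<Rightarrow> 'a::field) \<Rightarrow> ('a \<Rightarrow> 'a) topology" where
  "krull_topology \<iota> = topology_generated_by
    {\<sigma> <#\<^bsub>galois_group \<iota>\<^esub> {\<tau> \<in> carrier (galois_group \<iota>). \<forall>x\<in>L. \<tau> x = x} | \<sigma> L.
      \<sigma> \<in> carrier (galois_group \<iota>) \<and> finite_subextension \<iota> L}"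

definition gal_pt :: "('a \<Rightarrow> 'a) \<Rightarrow> ('a ^ 'v) set \<Rightarrow> ('a ^ 'v::finite) set" where
  "gal_pt \<sigma> p = (\<lambda>x. \<chi> i. \<sigma> (x $ i)) ` p"

definition gal_act ::
    "('a ^ 'v::finite) set set \<Rightarrow> ('a \<Rightarrow> 'a) \<Rightarrow>
      (('a ^ 'v) set \<Rightarrow> ('a ^ 'v) set) \<Rightarrow> ('a ^ 'v) set \<Rightarrow> ('a ^ 'v) set" where
  "gal_act V \<sigma> \<phi> = (\<lambda>p\<in>V. gal_pt \<sigma> (\<phi> (gal_pt (inv_into UNIV \<sigma>) p)))"


section \<open>Nonabelian cohomology\<close>

text \<open>\<open>\<Gamma>\<close> is a group with topology \<open>T\<close>, acting through \<open>act\<close> on the discrete group \<open>A\<close>.\<close>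

definition cocycles ::
    "('g, 'b) monoid_scheme \<Rightarrow> 'g topology \<Rightarrow> ('a, 'c) monoid_scheme \<Rightarrow> ('g \<Rightarrow> 'a \<Rightarrow> 'a) \<Rightarrow>
      ('g \<Rightarrow> 'a) set" where
  "cocycles \<Gamma> T A act =
    {a \<in> carrier \<Gamma> \<rightarrow>\<^sub>E carrier A. continuous_map T (discrete_topology (carrier A)) a \<and>
      (\<forall>s\<in>carrier \<Gamma>. \<forall>t\<in>carrier \<Gamma>. a (s \<otimes>\<^bsub>\<Gamma>\<^esub> t) = a s \<otimes>\<^bsub>A\<^esub> act s (a t))}"

definition cohomologous ::
    "('g, 'b) monoid_scheme \<Rightarrow> 'g topology \<Rightarrow> ('a, 'c) monoid_scheme \<Rightarrow> ('g \<Rightarrow> 'a \<Rightarrow> 'a) \<Rightarrow>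
      (('g \<Rightarrow> 'a) \<times> ('g \<Rightarrow> 'a)) set" where
  "cohomologous \<Gamma> T A act =
    {(a, a'). a \<in> cocycles \<Gamma> T A act \<and> a' \<in> cocycles \<Gamma> T A act \<and>
      (\<exists>b\<in>carrier A. \<forall>s\<in>carrier \<Gamma>. a' s = inv\<^bsub>A\<^esub> b \<otimes>\<^bsub>A\<^esub> a s \<otimes>\<^bsub>A\<^esub> act s b)}"

definition H1 ::
    "('g, 'b) monoid_scheme \<Rightarrow> 'g topology \<Rightarrow> ('a, 'c) monoid_scheme \<Rightarrow> ('g \<Rightarrow> 'a \<Rightarrow> 'a) \<Rightarrow>
      ('g \<Rightarrow> 'a) set set" where
  "H1 \<Gamma> T A act = cocycles \<Gamma> T A act // cohomologous \<Gamma> T A act"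

definition trivial_act :: "'g \<Rightarrow> 'a \<Rightarrow> 'a" where
  "trivial_act s a = a"

definition twisted_act ::
    "('a, 'c) monoid_scheme \<Rightarrow> ('g \<Rightarrow> 'a \<Rightarrow> 'a) \<Rightarrow> ('p \<Rightarrow> 'a) \<Rightarrow> ('g \<Rightarrow> 'p) \<Rightarrow> 'g \<Rightarrow> 'a \<Rightarrow> 'a" where
  "twisted_act A act s c \<gamma> \<mu> = s (c \<gamma>) \<otimes>\<^bsub>A\<^esub> act \<gamma> \<mu> \<otimes>\<^bsub>A\<^esub> inv\<^bsub>A\<^esub> (s (c \<gamma>))"

definition cocycle_centralizer ::
    "('g, 'b) monoid_scheme \<Rightarrow> ('p, 'd) monoid_scheme \<Rightarrow> ('g \<Rightarrow> 'p) \<Rightarrow> 'p set" where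
  "cocycle_centralizer \<Gamma> P c =
    {p \<in> carrier P. \<forall>\<gamma>\<in>carrier \<Gamma>. c \<gamma> \<otimes>\<^bsub>P\<^esub> p \<otimes>\<^bsub>P\<^esub> inv\<^bsub>P\<^esub> (c \<gamma>) = p}"

text \<open>The map on cohomology classes with values in a subgroup \<open>D\<close> of \<open>A\<close> that sends the class of
  \<open>\<mu>\<close> to the class of \<open>\<gamma> \<mapsto> g\<inverse> \<mu>\<^sub>\<gamma> g\<close>, where \<open>g\<close> is an element of \<open>A\<close>.\<close>

definition H1_conj ::
    "('g, 'b) monoid_scheme \<Rightarrow> 'g topology \<Rightarrow> 'a monoid \<Rightarrow> 'a set \<Rightarrow> ('g \<Rightarrow> 'a \<Rightarrow> 'a) \<Rightarrow>
      'a \<Rightarrow> ('g \<Rightarrow> 'a) set \<Rightarrow> ('g \<Rightarrow> 'a) set" where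
  "H1_conj \<Gamma> T A D act g C =
    (\<Union>\<mu>\<in>C. cohomologous \<Gamma> T (A\<lparr>carrier := D\<rparr>) act ``
      {\<lambda>\<gamma>\<in>carrier \<Gamma>. inv\<^bsub>A\<^esub> g \<otimes>\<^bsub>A\<^esub> \<mu> \<gamma> \<otimes>\<^bsub>A\<^esub> g})"

text \<open>The orbit set of \<open>C\<^sub>P(c)\<close> on the first cohomology of \<open>D\<close> twisted by the cocycle \<open>c\<close>.\<close>

definition twisted_H1_orbits ::
    "('g, 'b) monoid_scheme \<Rightarrow> 'g topology \<Rightarrow> 'a monoid \<Rightarrow> ('g \<Rightarrow> 'a \<Rightarrow> 'a) \<Rightarrow> 'a set \<Rightarrow>
      'p monoid \<Rightarrow> ('p \<Rightarrow> 'a) \<Rightarrow> ('g \<Rightarrow> 'p) \<Rightarrow> ('g \<Rightarrow> 'a) set set set" where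
  "twisted_H1_orbits \<Gamma> T A act D P s c =
    orbits (P\<lparr>carrier := cocycle_centralizer \<Gamma> P c\<rparr>)
      (H1 \<Gamma> T (A\<lparr>carrier := D\<rparr>) (twisted_act A act s c))
      (\<lambda>p. H1_conj \<Gamma> T A D (twisted_act A act s c) (s p))"

end

theory Submission
  imports Defs
begin

text \<open>
  The Galois action fixes the permutation matrices, so a cocycle with values in \<open>A = D \<rtimes> P\<close> is a product
  \<open>\<mu> \<cdot> s(c)\<close> of a cocycle \<open>c\<close> in \<open>P\<close>, which is just a continuous homomorphism, and a cocycle \<open>\<mu>\<close> in \<open>D\<close>
  for the action twisted by \<open>c\<close>. Conjugating by \<open>s(p)\<close> moves \<open>c\<close> to any chosen representative of its
  class; what is left of the coboundary relation is then that of the twisted \<open>D\<close> together with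
  conjugation by the centralizer of \<open>c\<close>. Hence the fibre of \<open>H\<^sup>1(\<Gamma>, A) \<rightarrow> H\<^sup>1(\<Gamma>, P)\<close> over the class of \<open>c\<close>
  is \<open>H\<^sup>1(\<Gamma>, \<^sub>cD) / C\<^sub>P(c)\<close>.

  The base is finite: for a base field isomorphic to the reals, \<open>\<Gamma>\<close> has at most two
  elements; for a finite field, the powers of the Frobenius are dense in \<open>\<Gamma>\<close>, so a continuous
  homomorphism to \<open>P\<close> is determined by the image of the Frobenius.
\<close>

section \<open>Extended cardinalities\<close>

text \<open>An Isabelle sum over an infinite index set is zero, so the formula has its intended
  meaning only once \<open>H1\<close> of \<open>P\<close> is known to be finite; the summands are
  measured in \<open>enat\<close>, which also admits infinite sets. The base field enters exactly in
  this finiteness. Over a finite field it is not enough that a Galois automorphism acts on each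
  single element as some power of the Frobenius: a neighbourhood prescribes finitely many values at
  once, and one exponent must serve them all. These elements lie in a finite subfield with cyclic
  multiplicative group, so an exponent that is right for a generator is right for all of them. Over
  a field isomorphic to the reals, the fundamental theorem of algebra is carried over from
  \<open>complex\<close>. The cohomological part is done for an abstract semidirect product. The
  geometry feeds it with three facts: the Galois action is by group endomorphisms, it preserves
  \<open>D\<close>, and it fixes the image of \<open>P\<close>. As automorphisms are biregular maps
  here and not matrices, the first fact needs an argument about local polynomial
  representations.\<close>

lemma ecard_Un_disjoint:
  assumes "A \<inter> B = {}"
  shows "ecard (A \<union> B) = ecard A + ecard B"
  using assms by (auto simp: ecard_def card_Un_disjoint)

lemma ecard_UN_disjoint:
  assumes "finite I" "\<And>i j. i \<in> I \<Longrightarrow> j \<in> I \<Longrightarrow> i \<noteq> j \<Longrightarrow> S i \<inter> S j = {}"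
  shows "ecard (\<Union>i\<in>I. S i) = (\<Sum>i\<in>I. ecard (S i))"
  using assms
proof (induction I rule: finite_induct)
  case (insert i I)
  have "S i \<inter> (\<Union>i\<in>I. S i) = {}"
    using insert.prems insert.hyps by fastforce
  then show ?case
    using insert by (simp add: ecard_Un_disjoint)
qed (simp add: ecard_def zero_enat_def)

text \<open>Sending \<open>f x\<close> to \<open>g x\<close> is well defined and injective as soon
  as \<open>f\<close> and \<open>g\<close> have the same fibres on \<open>S\<close>. It compares
  sets of orbits with sets of cohomology classes.\<close>

lemma ecard_image_eq:
  assumes "\<And>x y. x \<in> S \<Longrightarrow> y \<in> S \<Longrightarrow> f x = f y \<longleftrightarrow> g x = g y"
  shows "ecard (f ` S) = ecard (g ` S)"
proof -
  define h where "h z = g (SOME x. x \<in> S \<and> f x = z)" for z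
  have h: "h (f x) = g x" if "x \<in> S" for x
  proof -
    have "(SOME y. y \<in> S \<and> f y = f x) \<in> S \<and> f (SOME y. y \<in> S \<and> f y = f x) = f x"
      by (rule someI) (use that in auto)
    then show ?thesis
      using assms that unfolding h_def by blast
  qed
  have "inj_on h (f ` S)"
    using h assms by (auto intro!: inj_onI)
  moreover have "h ` f ` S = g ` S"
    using h by (force simp: image_image)
  ultimately have "bij_betw h (f ` S) (g ` S)"
    by (simp add: bij_betw_def)
  then show ?thesis
    by (simp add: ecard_def bij_betw_finite bij_betw_same_card)
qed


section \<open>Cocycles\<close>

lemma (in group) inv_mult_cancel_left:
  assumes "x \<in> carrier G" "y \<in> carrier G"
  shows "inv x \<otimes> (x \<otimes> y) = y" "x \<otimes> (inv x \<otimes> y) = y"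
  using assms by (simp_all add: m_assoc[symmetric])

text \<open>Near \<open>x\<close> the maps \<open>f\<close> and \<open>g\<close> are both constant,
  on the intersection of two open fibres, hence so is \<open>k\<close>. This gives the continuity of
  every cocycle built pointwise from others.\<close>

lemma continuous_map_discrete_combine:
  assumes "continuous_map T (discrete_topology A) f" "continuous_map T (discrete_topology B) g"
    and "\<And>x. x \<in> topspace T \<Longrightarrow> k x = h (f x) (g x)"
    and "\<And>x. x \<in> topspace T \<Longrightarrow> k x \<in> C"
  shows "continuous_map T (discrete_topology C) k"
proof -
  have "openin T {x \<in> topspace T. k x \<in> U}" for U
  proof (subst openin_subopen, safe)
    fix x assume x: "x \<in> topspace T" "k x \<in> U"
    define W where "W = {y \<in> topspace T. f y \<in> {f x}} \<inter> {y \<in> topspace T. g y \<in> {g x}}"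
    have "f x \<in> A" "g x \<in> B"
      using assms(1,2) x by (auto simp: continuous_map_def Pi_iff)
    then have "openin T W"
      unfolding W_def using assms(1,2) by (intro openin_Int openin_continuous_map_preimage) auto
    moreover have "x \<in> W" "W \<subseteq> {y \<in> topspace T. k y \<in> U}"
      using x assms(3) by (auto simp: W_def)
    ultimately show "\<exists>W. openin T W \<and> x \<in> W \<and> W \<subseteq> {y \<in> topspace T. k y \<in> U}"
      by blast
  qed
  then show ?thesis
    using assms(4) by (auto simp: continuous_map_def)
qed

lemma continuous_map_discrete_image:
  assumes "continuous_map T (discrete_topology A) f"
    and "\<And>x. x \<in> topspace T \<Longrightarrow> k x = h (f x)"
    and "\<And>x. x \<in> topspace T \<Longrightarrow> k x \<in> C"
  shows "continuous_map T (discrete_topology C) k"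
  using continuous_map_discrete_combine[OF assms(1) assms(1), of k "\<lambda>a _. h a"] assms(2,3) by blast

text \<open>The witnesses are the unit, \<open>inv b\<close> and the product of \<open>b\<close> and
  \<open>b'\<close>. The general form covers \<open>A\<close>, \<open>P\<close> with trivial action
  and \<open>D\<close> with a twisted action.\<close>

lemma equiv_cohomologous:
  assumes "group A" and hom: "\<And>s. s \<in> carrier \<Gamma> \<Longrightarrow> act s \<in> hom A A"
  shows "equiv (cocycles \<Gamma> T A act) (cohomologous \<Gamma> T A act)"
proof (rule equivI)
  interpret group A by fact
  have h: "act s \<one>\<^bsub>A\<^esub> = \<one>\<^bsub>A\<^esub>" "\<And>b. b \<in> carrier A \<Longrightarrow> act s b \<in> carrier A"
    "\<And>b b'. b \<in> carrier A \<Longrightarrow> b' \<in> carrier A \<Longrightarrow> act s (b \<otimes>\<^bsub>A\<^esub> b') = act s b \<otimes>\<^bsub>A\<^esub> act s b'"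
    "\<And>b. b \<in> carrier A \<Longrightarrow> act s (inv\<^bsub>A\<^esub> b) = inv\<^bsub>A\<^esub> (act s b)"
    if "s \<in> carrier \<Gamma>" for s
  proof -
    interpret h: group_hom A A "act s"
      using hom[OF that] by unfold_locales
    show "act s \<one>\<^bsub>A\<^esub> = \<one>\<^bsub>A\<^esub>" "\<And>b. b \<in> carrier A \<Longrightarrow> act s b \<in> carrier A"
      "\<And>b b'. b \<in> carrier A \<Longrightarrow> b' \<in> carrier A \<Longrightarrow> act s (b \<otimes>\<^bsub>A\<^esub> b') = act s b \<otimes>\<^bsub>A\<^esub> act s b'"
      "\<And>b. b \<in> carrier A \<Longrightarrow> act s (inv\<^bsub>A\<^esub> b) = inv\<^bsub>A\<^esub> (act s b)"
      by simp_all
  qed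
  have c: "a s \<in> carrier A" if "a \<in> cocycles \<Gamma> T A act" "s \<in> carrier \<Gamma>" for a s
    using that by (auto simp: cocycles_def)
  show "cohomologous \<Gamma> T A act \<subseteq> cocycles \<Gamma> T A act \<times> cocycles \<Gamma> T A act"
    by (auto simp: cohomologous_def)
  show "refl_on (cocycles \<Gamma> T A act) (cohomologous \<Gamma> T A act)"
    by (rule refl_onI) (auto simp: cohomologous_def h c intro!: bexI[of _ "\<one>\<^bsub>A\<^esub>"])
  show "sym (cohomologous \<Gamma> T A act)"
  proof (rule symI)
    fix a a' assume "(a, a') \<in> cohomologous \<Gamma> T A act"
    then obtain b where ab: "a \<in> cocycles \<Gamma> T A act" "a' \<in> cocycles \<Gamma> T A act" "b \<in> carrier A"
      "\<And>s. s \<in> carrier \<Gamma> \<Longrightarrow> a' s = inv\<^bsub>A\<^esub> b \<otimes>\<^bsub>A\<^esub> a s \<otimes>\<^bsub>A\<^esub> act s b"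
      by (auto simp: cohomologous_def)
    then show "(a', a) \<in> cohomologous \<Gamma> T A act"
      by (auto simp: cohomologous_def h c m_assoc inv_mult_cancel_left
          intro!: bexI[of _ "inv\<^bsub>A\<^esub> b"])
  qed
  show "trans (cohomologous \<Gamma> T A act)"
  proof (rule transI)
    fix a a' a'' assume "(a, a') \<in> cohomologous \<Gamma> T A act" "(a', a'') \<in> cohomologous \<Gamma> T A act"
    then obtain b b' where ab: "a \<in> cocycles \<Gamma> T A act" "a'' \<in> cocycles \<Gamma> T A act"
        "b \<in> carrier A" "b' \<in> carrier A"
      "\<And>s. s \<in> carrier \<Gamma> \<Longrightarrow> a' s = inv\<^bsub>A\<^esub> b \<otimes>\<^bsub>A\<^esub> a s \<otimes>\<^bsub>A\<^esub> act s b"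
      "\<And>s. s \<in> carrier \<Gamma> \<Longrightarrow> a'' s = inv\<^bsub>A\<^esub> b' \<otimes>\<^bsub>A\<^esub> a' s \<otimes>\<^bsub>A\<^esub> act s b'"
      by (auto simp: cohomologous_def)
    then show "(a, a'') \<in> cohomologous \<Gamma> T A act"
      by (auto simp: cohomologous_def h c m_assoc inv_mult_group
          intro!: bexI[of _ "b \<otimes>\<^bsub>A\<^esub> b'"])
  qed
qed


section \<open>Cohomology of a semidirect product\<close>

text \<open>The interface between geometry and cohomology. Cochains are given by formulas on
  \<open>carrier \<Gamma>\<close> only, and \<open>topspace_subset\<close> makes these formulas
  available at every point of \<open>T\<close>.\<close>

locale semidirect_with_action =
  fixes \<Gamma> :: "('g, 'b) monoid_scheme" and T :: "'g topology"
    and A :: "'a monoid" and act :: "'g \<Rightarrow> 'a \<Rightarrow> 'a" and D :: "'a set"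
    and P :: "'p monoid" and s :: "'p \<Rightarrow> 'a"
  assumes mult_closed: "\<And>x y. x \<in> carrier \<Gamma> \<Longrightarrow> y \<in> carrier \<Gamma> \<Longrightarrow> x \<otimes>\<^bsub>\<Gamma>\<^esub> y \<in> carrier \<Gamma>"
    and topspace_subset: "topspace T \<subseteq> carrier \<Gamma>"
    and group_P: "group P"
    and semidirect_ADP: "semidirect A D P s"
    and act_hom: "\<And>x. x \<in> carrier \<Gamma> \<Longrightarrow> act x \<in> hom A A"
    and act_D: "\<And>x a. x \<in> carrier \<Gamma> \<Longrightarrow> a \<in> D \<Longrightarrow> act x a \<in> D"
    and act_s: "\<And>x p. x \<in> carrier \<Gamma> \<Longrightarrow> p \<in> carrier P \<Longrightarrow> act x (s p) = s p"
begin

sublocale A: group A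
  using semidirect_ADP by (auto simp: semidirect_def normal_def)

sublocale D: normal D A
  using semidirect_ADP by (simp add: semidirect_def)

sublocale P: group P
  by (rule group_P)

sublocale s: group_hom P A s
  using semidirect_ADP by unfold_locales (simp add: semidirect_def mon_def)

lemmas word_simps = A.m_assoc A.inv_mult_group A.inv_mult_cancel_left

lemma D_conj:
  assumes "a \<in> carrier A" "x \<in> D"
  shows "a \<otimes>\<^bsub>A\<^esub> x \<otimes>\<^bsub>A\<^esub> inv\<^bsub>A\<^esub> a \<in> D" "inv\<^bsub>A\<^esub> a \<otimes>\<^bsub>A\<^esub> x \<otimes>\<^bsub>A\<^esub> a \<in> D"
  using D.inv_op_closed1 D.inv_op_closed2 assms by auto

lemma act_simps:
  assumes "x \<in> carrier \<Gamma>"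
  shows "a \<in> carrier A \<Longrightarrow> act x a \<in> carrier A"
    "a \<in> carrier A \<Longrightarrow> b \<in> carrier A \<Longrightarrow> act x (a \<otimes>\<^bsub>A\<^esub> b) = act x a \<otimes>\<^bsub>A\<^esub> act x b"
    "a \<in> carrier A \<Longrightarrow> act x (inv\<^bsub>A\<^esub> a) = inv\<^bsub>A\<^esub> (act x a)"
proof -
  interpret h: group_hom A A "act x"
    using act_hom[OF assms] by unfold_locales
  show "a \<in> carrier A \<Longrightarrow> act x a \<in> carrier A"
    "a \<in> carrier A \<Longrightarrow> b \<in> carrier A \<Longrightarrow> act x (a \<otimes>\<^bsub>A\<^esub> b) = act x a \<otimes>\<^bsub>A\<^esub> act x b"
    "a \<in> carrier A \<Longrightarrow> act x (inv\<^bsub>A\<^esub> a) = inv\<^bsub>A\<^esub> (act x a)"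
    by simp_all
qed

section \<open>The decomposition of an element and the projection of \<open>A\<close> onto
  \<open>P\<close>\<close>

lemma decompose:
  assumes "a \<in> carrier A"
  obtains x p where "x \<in> D" "p \<in> carrier P" "a = x \<otimes>\<^bsub>A\<^esub> s p"
  using assms semidirect_ADP unfolding semidirect_def set_mult_def by blast

lemma decompose_unique:
  assumes "x \<in> D" "y \<in> D" "p \<in> carrier P" "q \<in> carrier P" "x \<otimes>\<^bsub>A\<^esub> s p = y \<otimes>\<^bsub>A\<^esub> s q"
  shows "x = y" "p = q"
proof -
  have [simp]: "x \<in> carrier A" "y \<in> carrier A"
    using assms by auto
  have "inv\<^bsub>A\<^esub> y \<otimes>\<^bsub>A\<^esub> x = inv\<^bsub>A\<^esub> y \<otimes>\<^bsub>A\<^esub> (x \<otimes>\<^bsub>A\<^esub> s p) \<otimes>\<^bsub>A\<^esub> inv\<^bsub>A\<^esub> (s p)"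
    using assms(1-4) by (simp add: word_simps)
  also have "\<dots> = s (q \<otimes>\<^bsub>P\<^esub> inv\<^bsub>P\<^esub> p)"
    unfolding assms(5) using assms(1-4) by (simp add: word_simps)
  finally have "inv\<^bsub>A\<^esub> y \<otimes>\<^bsub>A\<^esub> x \<in> D \<inter> s ` carrier P"
    using assms(1-4) subgroup.m_closed[OF D.subgroup_axioms] subgroup.m_inv_closed[OF D.subgroup_axioms]
    by (metis IntI P.inv_closed P.m_closed imageI)
  then have "inv\<^bsub>A\<^esub> y \<otimes>\<^bsub>A\<^esub> x = \<one>\<^bsub>A\<^esub>"
    using semidirect_ADP by (auto simp: semidirect_def)
  then show "x = y"
    by (metis A.inv_equality A.inv_inv A.inv_closed \<open>x \<in> carrier A\<close> \<open>y \<in> carrier A\<close>)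
  then have "s p = s q"
    using assms by (metis A.l_cancel s.hom_closed \<open>x \<in> carrier A\<close>)
  then show "p = q"
    using assms semidirect_ADP by (auto simp: semidirect_def mon_def inj_on_def)
qed

text \<open>The quotient map from \<open>A\<close> to \<open>A/D\<close>, with the quotient
  identified with \<open>P\<close> through \<open>s\<close>.\<close>

definition pr :: "'a \<Rightarrow> 'p" where
  "pr a = (THE p. p \<in> carrier P \<and> (\<exists>x\<in>D. a = x \<otimes>\<^bsub>A\<^esub> s p))"

lemma pr_eqI:
  assumes "x \<in> D" "p \<in> carrier P" "a = x \<otimes>\<^bsub>A\<^esub> s p"
  shows "pr a = p"
  unfolding pr_def using assms decompose_unique(2) by blast

lemma pr_closed [simp]: "a \<in> carrier A \<Longrightarrow> pr a \<in> carrier P"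
  by (erule decompose) (simp add: pr_eqI)

lemma pr_rem: "a \<in> carrier A \<Longrightarrow> a \<otimes>\<^bsub>A\<^esub> inv\<^bsub>A\<^esub> (s (pr a)) \<in> D"
  by (erule decompose) (simp add: pr_eqI word_simps)

lemma pr_s [simp]: "p \<in> carrier P \<Longrightarrow> pr (s p) = p"
  by (rule pr_eqI[of "\<one>\<^bsub>A\<^esub>"]) auto

text \<open>Moving \<open>s p\<close> past \<open>y\<close> replaces \<open>y\<close> by its
  conjugate under \<open>s p\<close>, which normality keeps in \<open>D\<close>.\<close>

lemma pr_mult [simp]:
  assumes "a \<in> carrier A" "b \<in> carrier A"
  shows "pr (a \<otimes>\<^bsub>A\<^esub> b) = pr a \<otimes>\<^bsub>P\<^esub> pr b"
proof -
  obtain x p where a: "x \<in> D" "p \<in> carrier P" "a = x \<otimes>\<^bsub>A\<^esub> s p"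
    using assms decompose by blast
  obtain y q where b: "y \<in> D" "q \<in> carrier P" "b = y \<otimes>\<^bsub>A\<^esub> s q"
    using assms decompose by blast
  have "a \<otimes>\<^bsub>A\<^esub> b = x \<otimes>\<^bsub>A\<^esub> (s p \<otimes>\<^bsub>A\<^esub> y \<otimes>\<^bsub>A\<^esub> inv\<^bsub>A\<^esub> (s p)) \<otimes>\<^bsub>A\<^esub> s (p \<otimes>\<^bsub>P\<^esub> q)"
    using a b by (simp add: word_simps)
  then have "pr (a \<otimes>\<^bsub>A\<^esub> b) = p \<otimes>\<^bsub>P\<^esub> q"
    using a b by (intro pr_eqI) (auto intro!: D_conj)
  then show ?thesis
    using pr_eqI a b by metis
qed

sublocale pr: group_hom A P pr
  by unfold_locales (auto simp: hom_def)

text \<open>The action preserves the \<open>D\<close>-factor and fixes the \<open>P\<close>-factor,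
  so the induced action on the quotient is trivial. This is why \<open>trivial_act\<close> is the
  right action on \<open>P\<close>.\<close>

lemma pr_act:
  assumes "x \<in> carrier \<Gamma>" "a \<in> carrier A"
  shows "pr (act x a) = pr a"
proof -
  obtain y p where a: "y \<in> D" "p \<in> carrier P" "a = y \<otimes>\<^bsub>A\<^esub> s p"
    using assms decompose by blast
  have "act x a = act x y \<otimes>\<^bsub>A\<^esub> s p"
    using a assms by (simp add: act_simps act_s)
  then have "pr (act x a) = p"
    using a assms by (intro pr_eqI) (auto intro: act_D)
  then show ?thesis
    using pr_eqI a by metis
qed

lemma pr_D: "a \<in> D \<Longrightarrow> pr a = \<one>\<^bsub>P\<^esub>"
  by (rule pr_eqI[of a]) auto

section \<open>Cocycles with values in \<open>A\<close>, in \<open>P\<close> and in the twisted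
  \<open>D\<close>\<close>

abbreviation "ZA \<equiv> cocycles \<Gamma> T A act"
abbreviation "RA \<equiv> cohomologous \<Gamma> T A act"
abbreviation "ZP \<equiv> cocycles \<Gamma> T P trivial_act"
abbreviation "RP \<equiv> cohomologous \<Gamma> T P trivial_act"
abbreviation "ZD c \<equiv> cocycles \<Gamma> T (A\<lparr>carrier := D\<rparr>) (twisted_act A act s c)"
abbreviation "RD c \<equiv> cohomologous \<Gamma> T (A\<lparr>carrier := D\<rparr>) (twisted_act A act s c)"

text \<open>The twisting bijection at the level of cochains: it identifies twisted cocycles in
  \<open>D\<close> with the cocycles in \<open>A\<close> that lie exactly over
  \<open>c\<close>.\<close>

definition untwist :: "('g \<Rightarrow> 'p) \<Rightarrow> ('g \<Rightarrow> 'a) \<Rightarrow> 'g \<Rightarrow> 'a" where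
  "untwist c \<mu> = (\<lambda>x\<in>carrier \<Gamma>. \<mu> x \<otimes>\<^bsub>A\<^esub> s (c x))"

definition project :: "('g \<Rightarrow> 'a) \<Rightarrow> 'g \<Rightarrow> 'p" where
  "project a = (\<lambda>x\<in>carrier \<Gamma>. pr (a x))"

text \<open>The cochain underlying \<open>H1_conj\<close>, also applied to cocycles with values in
  \<open>A\<close>.\<close>

definition conjugate :: "'a \<Rightarrow> ('g \<Rightarrow> 'a) \<Rightarrow> 'g \<Rightarrow> 'a" where
  "conjugate g \<mu> = (\<lambda>x\<in>carrier \<Gamma>. inv\<^bsub>A\<^esub> g \<otimes>\<^bsub>A\<^esub> \<mu> x \<otimes>\<^bsub>A\<^esub> g)"

lemma ZA_iff:
  "a \<in> ZA \<longleftrightarrow> a \<in> carrier \<Gamma> \<rightarrow>\<^sub>E carrier A \<and> continuous_map T (discrete_topology (carrier A)) a \<and>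
    (\<forall>x\<in>carrier \<Gamma>. \<forall>y\<in>carrier \<Gamma>. a (x \<otimes>\<^bsub>\<Gamma>\<^esub> y) = a x \<otimes>\<^bsub>A\<^esub> act x (a y))"
  by (auto simp: cocycles_def)

lemma ZP_iff:
  "c \<in> ZP \<longleftrightarrow> c \<in> carrier \<Gamma> \<rightarrow>\<^sub>E carrier P \<and> continuous_map T (discrete_topology (carrier P)) c \<and>
    (\<forall>x\<in>carrier \<Gamma>. \<forall>y\<in>carrier \<Gamma>. c (x \<otimes>\<^bsub>\<Gamma>\<^esub> y) = c x \<otimes>\<^bsub>P\<^esub> c y)"
  by (auto simp: cocycles_def trivial_act_def)

lemma ZD_iff:
  "\<mu> \<in> ZD c \<longleftrightarrow> \<mu> \<in> carrier \<Gamma> \<rightarrow>\<^sub>E D \<and> continuous_map T (discrete_topology D) \<mu> \<and>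
    (\<forall>x\<in>carrier \<Gamma>. \<forall>y\<in>carrier \<Gamma>. \<mu> (x \<otimes>\<^bsub>\<Gamma>\<^esub> y) =
      \<mu> x \<otimes>\<^bsub>A\<^esub> (s (c x) \<otimes>\<^bsub>A\<^esub> act x (\<mu> y) \<otimes>\<^bsub>A\<^esub> inv\<^bsub>A\<^esub> (s (c x))))"
  by (auto simp: cocycles_def twisted_act_def)

lemma equiv_RA: "equiv ZA RA"
  by (rule equiv_cohomologous) (auto intro: act_hom)

lemma equiv_RP: "equiv ZP RP"
  by (rule equiv_cohomologous) (auto simp: hom_def trivial_act_def)

lemma ZP_closed: "c \<in> ZP \<Longrightarrow> x \<in> carrier \<Gamma> \<Longrightarrow> c x \<in> carrier P"
  by (auto simp: ZP_iff)

lemma cocycle_continuous: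
  "c \<in> ZP \<Longrightarrow> continuous_map T (discrete_topology (carrier P)) c"
  "a \<in> ZA \<Longrightarrow> continuous_map T (discrete_topology (carrier A)) a"
  "\<mu> \<in> ZD d \<Longrightarrow> continuous_map T (discrete_topology D) \<mu>"
  by (simp_all add: cocycles_def)

lemma cocycle_undefined:
  assumes "x \<notin> carrier \<Gamma>"
  shows "c \<in> ZP \<Longrightarrow> c x = undefined" "a \<in> ZA \<Longrightarrow> a x = undefined" "\<mu> \<in> ZD d \<Longrightarrow> \<mu> x = undefined"
  using assms by (auto simp: cocycles_def PiE_iff extensional_def)

lemma ZA_closed: "a \<in> ZA \<Longrightarrow> x \<in> carrier \<Gamma> \<Longrightarrow> a x \<in> carrier A"
  by (auto simp: ZA_iff)

lemma ZD_mem: "\<mu> \<in> ZD c \<Longrightarrow> x \<in> carrier \<Gamma> \<Longrightarrow> \<mu> x \<in> D"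
  by (auto simp: ZD_iff)

lemma ZD_closed: "\<mu> \<in> ZD c \<Longrightarrow> x \<in> carrier \<Gamma> \<Longrightarrow> \<mu> x \<in> carrier A"
  by (rule D.mem_carrier) (rule ZD_mem)

text \<open>The twisted action is \<open>act x\<close> followed by conjugation with
  \<open>s (c x)\<close>; both are homomorphisms and both map \<open>D\<close> into itself.\<close>

lemma equiv_RD:
  assumes "c \<in> ZP"
  shows "equiv (ZD c) (RD c)"
proof (rule equiv_cohomologous)
  show "group (A\<lparr>carrier := D\<rparr>)"
    using D.subgroup_axioms A.subgroup_imp_group by blast
  fix x assume x: "x \<in> carrier \<Gamma>"
  then show "twisted_act A act s c x \<in> hom (A\<lparr>carrier := D\<rparr>) (A\<lparr>carrier := D\<rparr>)"
    using ZP_closed[OF assms x] D_conj(1)[of "s (c x)" "act x _"]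
    by (auto simp: hom_def twisted_act_def act_simps act_D) (simp add: act_simps word_simps)
qed

lemma RD_refl: "c \<in> ZP \<Longrightarrow> \<mu> \<in> ZD c \<Longrightarrow> (\<mu>, \<mu>) \<in> RD c"
  by (erule equivE[OF equiv_RD]) (erule refl_onD)

lemma RA_refl: "a \<in> ZA \<Longrightarrow> (a, a) \<in> RA"
  by (rule equivE[OF equiv_RA]) (erule refl_onD)

lemma RA_trans: "(a, b) \<in> RA \<Longrightarrow> (b, c) \<in> RA \<Longrightarrow> (a, c) \<in> RA"
  by (rule equivE[OF equiv_RA]) (erule transD)

lemma RD_iff:
  "(\<mu>, \<mu>') \<in> RD c \<longleftrightarrow> \<mu> \<in> ZD c \<and> \<mu>' \<in> ZD c \<and> (\<exists>b\<in>D. \<forall>x\<in>carrier \<Gamma>.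
    \<mu>' x = inv\<^bsub>A\<^esub> b \<otimes>\<^bsub>A\<^esub> \<mu> x \<otimes>\<^bsub>A\<^esub> (s (c x) \<otimes>\<^bsub>A\<^esub> act x b \<otimes>\<^bsub>A\<^esub> inv\<^bsub>A\<^esub> (s (c x))))"
  using A.m_inv_consistent[OF D.subgroup_axioms]
  by (auto simp: cohomologous_def twisted_act_def)

lemma RA_iff:
  "(a, a') \<in> RA \<longleftrightarrow> a \<in> ZA \<and> a' \<in> ZA \<and> (\<exists>b\<in>carrier A. \<forall>x\<in>carrier \<Gamma>.
    a' x = inv\<^bsub>A\<^esub> b \<otimes>\<^bsub>A\<^esub> a x \<otimes>\<^bsub>A\<^esub> act x b)"
  by (auto simp: cohomologous_def)

lemma project_ZP:
  assumes "a \<in> ZA"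
  shows "project a \<in> ZP"
proof -
  have "continuous_map T (discrete_topology (carrier P)) (project a)"
    by (rule continuous_map_discrete_image[OF cocycle_continuous(2)[OF assms], of _ pr])
      (use topspace_subset ZA_closed[OF assms] in \<open>auto simp: project_def subset_iff\<close>)
  then show ?thesis
    using assms ZA_closed[OF assms]
    by (simp add: ZP_iff) (auto simp: ZA_iff project_def mult_closed act_simps pr_act)
qed

lemma project_RP:
  assumes "(a, a') \<in> RA"
  shows "(project a, project a') \<in> RP"
proof -
  obtain b where b: "b \<in> carrier A"
    "\<And>x. x \<in> carrier \<Gamma> \<Longrightarrow> a' x = inv\<^bsub>A\<^esub> b \<otimes>\<^bsub>A\<^esub> a x \<otimes>\<^bsub>A\<^esub> act x b"
    and a: "a \<in> ZA" "a' \<in> ZA"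
    using assms by (auto simp: RA_iff)
  have "project a' x = inv\<^bsub>P\<^esub> (pr b) \<otimes>\<^bsub>P\<^esub> project a x \<otimes>\<^bsub>P\<^esub> pr b" if "x \<in> carrier \<Gamma>" for x
    using b that ZA_closed[OF a(1) that] by (simp add: project_def act_simps pr_act)
  then show ?thesis
    using b a by (auto simp: cohomologous_def trivial_act_def project_ZP intro!: bexI[of _ "pr b"])
qed

text \<open>In the cocycle rule of \<open>\<mu>\<close> the trailing inverse of
  \<open>s (c x)\<close> cancels against the first factor of \<open>s\<close> at the product of
  \<open>c x\<close> and \<open>c y\<close>. What remains is the rule for \<open>A\<close>, because
  \<open>act x\<close> fixes \<open>s (c y)\<close>.\<close>

lemma untwist_ZA:
  assumes c: "c \<in> ZP" and \<mu>: "\<mu> \<in> ZD c"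
  shows "untwist c \<mu> \<in> ZA" "project (untwist c \<mu>) = c"
proof -
  have "continuous_map T (discrete_topology (carrier A)) (untwist c \<mu>)"
    by (rule continuous_map_discrete_combine[OF cocycle_continuous(3)[OF \<mu>] cocycle_continuous(1)[OF c],
          of _ "\<lambda>m p. m \<otimes>\<^bsub>A\<^esub> s p"])
      (use topspace_subset ZP_closed[OF c] ZD_closed[OF \<mu>] in \<open>auto simp: untwist_def subset_iff\<close>)
  moreover have "untwist c \<mu> (x \<otimes>\<^bsub>\<Gamma>\<^esub> y) = untwist c \<mu> x \<otimes>\<^bsub>A\<^esub> act x (untwist c \<mu> y)"
    if "x \<in> carrier \<Gamma>" "y \<in> carrier \<Gamma>" for x y
  proof -
    have "c (x \<otimes>\<^bsub>\<Gamma>\<^esub> y) = c x \<otimes>\<^bsub>P\<^esub> c y"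
      "\<mu> (x \<otimes>\<^bsub>\<Gamma>\<^esub> y) = \<mu> x \<otimes>\<^bsub>A\<^esub> (s (c x) \<otimes>\<^bsub>A\<^esub> act x (\<mu> y) \<otimes>\<^bsub>A\<^esub> inv\<^bsub>A\<^esub> (s (c x)))"
      using assms that by (auto simp: ZP_iff ZD_iff)
    then show ?thesis
      using that ZP_closed[OF c] ZD_closed[OF \<mu>]
      by (simp add: untwist_def mult_closed act_simps act_s word_simps)
  qed
  ultimately show "untwist c \<mu> \<in> ZA"
    using ZP_closed[OF c] ZD_closed[OF \<mu>]
    unfolding ZA_iff by (intro conjI) (simp_all add: untwist_def)
  have "project (untwist c \<mu>) x = c x" for x
    using c ZP_closed[OF c] ZD_mem[OF \<mu>] ZD_closed[OF \<mu>]
    by (cases "x \<in> carrier \<Gamma>") (auto simp: cocycle_undefined(1) project_def untwist_def pr_D)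
  then show "project (untwist c \<mu>) = c"
    by (rule ext)
qed

text \<open>Dividing \<open>a\<close> on the right by the permutation part leaves a
  \<open>D\<close>-valued map, and the computation for \<open>untwist_ZA\<close> runs
  backwards.\<close>

lemma untwist_surj:
  assumes a: "a \<in> ZA"
  obtains \<mu> where "\<mu> \<in> ZD (project a)" "untwist (project a) \<mu> = a"
proof -
  define c where "c = project a"
  have c: "c \<in> ZP"
    unfolding c_def using a by (rule project_ZP)
  define \<mu> where "\<mu> = (\<lambda>x\<in>carrier \<Gamma>. a x \<otimes>\<^bsub>A\<^esub> inv\<^bsub>A\<^esub> (s (c x)))"
  have mem: "\<mu> x \<in> D" if "x \<in> carrier \<Gamma>" for x
    using that ZA_closed[OF a that] by (simp add: \<mu>_def c_def project_def pr_rem)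
  have "continuous_map T (discrete_topology D) \<mu>"
    by (rule continuous_map_discrete_combine[OF cocycle_continuous(2)[OF a] cocycle_continuous(1)[OF c],
          of _ "\<lambda>b p. b \<otimes>\<^bsub>A\<^esub> inv\<^bsub>A\<^esub> (s p)"])
      (use topspace_subset mem in \<open>auto simp: \<mu>_def subset_iff\<close>)
  moreover have "\<mu> (x \<otimes>\<^bsub>\<Gamma>\<^esub> y) =
      \<mu> x \<otimes>\<^bsub>A\<^esub> (s (c x) \<otimes>\<^bsub>A\<^esub> act x (\<mu> y) \<otimes>\<^bsub>A\<^esub> inv\<^bsub>A\<^esub> (s (c x)))"
    if "x \<in> carrier \<Gamma>" "y \<in> carrier \<Gamma>" for x y
  proof -
    have "c (x \<otimes>\<^bsub>\<Gamma>\<^esub> y) = c x \<otimes>\<^bsub>P\<^esub> c y" "a (x \<otimes>\<^bsub>\<Gamma>\<^esub> y) = a x \<otimes>\<^bsub>A\<^esub> act x (a y)"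
      using a c that by (auto simp: ZP_iff ZA_iff)
    then show ?thesis
      using that ZP_closed[OF c] ZA_closed[OF a]
      by (simp add: \<mu>_def mult_closed act_simps act_s word_simps)
  qed
  ultimately have "\<mu> \<in> ZD c"
    using mem unfolding ZD_iff by (intro conjI) (simp_all add: \<mu>_def)
  moreover have "untwist c \<mu> x = a x" for x
    using ZP_closed[OF c] ZA_closed[OF a] a
    by (cases "x \<in> carrier \<Gamma>") (auto simp: cocycle_undefined(2) \<mu>_def untwist_def word_simps)
  then have "untwist c \<mu> = a"
    by (rule ext)
  ultimately show thesis
    using that[of \<mu>] unfolding c_def by simp
qed

section \<open>Conjugation by permutations and the classes within one fibre\<close>

lemma conj_ZA:
  assumes a: "a \<in> ZA" and p: "p \<in> carrier P"
  shows "(a, conjugate (s p) a) \<in> RA"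
proof -
  have "continuous_map T (discrete_topology (carrier A)) (conjugate (s p) a)"
    by (rule continuous_map_discrete_image[OF cocycle_continuous(2)[OF a],
          of _ "\<lambda>b. inv\<^bsub>A\<^esub> (s p) \<otimes>\<^bsub>A\<^esub> b \<otimes>\<^bsub>A\<^esub> s p"])
      (use topspace_subset p ZA_closed[OF a] in \<open>auto simp: conjugate_def subset_iff\<close>)
  moreover have "conjugate (s p) a (x \<otimes>\<^bsub>\<Gamma>\<^esub> y) = conjugate (s p) a x \<otimes>\<^bsub>A\<^esub> act x (conjugate (s p) a y)"
    if "x \<in> carrier \<Gamma>" "y \<in> carrier \<Gamma>" for x y
  proof -
    have "a (x \<otimes>\<^bsub>\<Gamma>\<^esub> y) = a x \<otimes>\<^bsub>A\<^esub> act x (a y)"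
      using a that by (auto simp: ZA_iff)
    then show ?thesis
      using that p ZA_closed[OF a]
      by (simp add: conjugate_def mult_closed act_simps act_s word_simps)
  qed
  ultimately have "conjugate (s p) a \<in> ZA"
    using ZA_closed[OF a] p unfolding ZA_iff by (intro conjI) (simp_all add: conjugate_def)
  \<comment> \<open>As \<open>act x\<close> fixes \<open>s p\<close>, conjugation by
    \<open>s p\<close> is the coboundary change with witness \<open>s p\<close>.\<close>
  then show ?thesis
    using a p by (auto simp: RA_iff conjugate_def act_s intro!: bexI[of _ "s p"])
qed

lemma centralizer_commute:
  assumes c: "c \<in> ZP" and p: "p \<in> cocycle_centralizer \<Gamma> P c" and x: "x \<in> carrier \<Gamma>"
  shows "c x \<otimes>\<^bsub>P\<^esub> p = p \<otimes>\<^bsub>P\<^esub> c x" "s (c x) \<otimes>\<^bsub>A\<^esub> s p = s p \<otimes>\<^bsub>A\<^esub> s (c x)"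
proof -
  have pP: "p \<in> carrier P" and e: "c x \<otimes>\<^bsub>P\<^esub> p \<otimes>\<^bsub>P\<^esub> inv\<^bsub>P\<^esub> c x = p"
    using p x by (auto simp: cocycle_centralizer_def)
  show "c x \<otimes>\<^bsub>P\<^esub> p = p \<otimes>\<^bsub>P\<^esub> c x"
    using P.inv_solve_right'[of p "c x \<otimes>\<^bsub>P\<^esub> p" "c x"] e pP ZP_closed[OF c x] by simp
  then show "s (c x) \<otimes>\<^bsub>A\<^esub> s p = s p \<otimes>\<^bsub>A\<^esub> s (c x)"
    using pP ZP_closed[OF c x] by (metis s.hom_mult)
qed

lemma conj_untwist:
  assumes c: "c \<in> ZP" and p: "p \<in> cocycle_centralizer \<Gamma> P c" and \<mu>: "\<mu> \<in> ZD c"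
  shows "untwist c (conjugate (s p) \<mu>) = conjugate (s p) (untwist c \<mu>)"
proof
  fix x
  have pP: "p \<in> carrier P"
    using p by (auto simp: cocycle_centralizer_def)
  show "untwist c (conjugate (s p) \<mu>) x = conjugate (s p) (untwist c \<mu>) x"
  proof (cases "x \<in> carrier \<Gamma>")
    case True
    then show ?thesis
      using pP ZD_closed[OF \<mu> True] ZP_closed[OF c True]
      by (simp add: untwist_def conjugate_def A.m_assoc centralizer_commute(2)[OF c p True, symmetric])
  qed (simp add: untwist_def conjugate_def)
qed

text \<open>The cocycle rule is not checked directly. The conjugate of
  \<open>untwist c \<mu>\<close> is a cocycle in \<open>A\<close> that still projects to
  \<open>c\<close>, because \<open>p\<close> centralizes \<open>c\<close>. Hence it is untwisted
  from some \<open>\<nu>\<close> in \<open>ZD c\<close>, and cancelling \<open>s (c x)\<close> shows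
  that \<open>\<nu>\<close> is the conjugate of \<open>\<mu>\<close>.\<close>

lemma conj_ZD:
  assumes c: "c \<in> ZP" and p: "p \<in> cocycle_centralizer \<Gamma> P c" and \<mu>: "\<mu> \<in> ZD c"
  shows "conjugate (s p) \<mu> \<in> ZD c"
proof -
  have pP: "p \<in> carrier P"
    using p by (auto simp: cocycle_centralizer_def)
  define a where "a = conjugate (s p) (untwist c \<mu>)"
  have a: "a \<in> ZA"
    using conj_ZA[OF untwist_ZA(1)[OF c \<mu>] pP] by (auto simp: a_def RA_iff)
  have "project a x = c x" for x
  proof (cases "x \<in> carrier \<Gamma>")
    case True
    note mem = ZP_closed[OF c True] ZD_mem[OF \<mu> True] ZD_closed[OF \<mu> True]
    have "project a x = inv\<^bsub>P\<^esub> p \<otimes>\<^bsub>P\<^esub> (c x \<otimes>\<^bsub>P\<^esub> p)"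
      using mem pP True by (simp add: a_def project_def untwist_def conjugate_def pr_D P.m_assoc)
    also have "\<dots> = c x"
      unfolding centralizer_commute(1)[OF c p True] using mem pP by (simp add: P.inv_mult_cancel_left)
    finally show ?thesis .
  next
    case False
    then show ?thesis
      using cocycle_undefined(1)[OF False c] by (simp add: project_def)
  qed
  then have pa: "project a = c"
    by (rule ext)
  obtain \<nu> where \<nu>: "\<nu> \<in> ZD c" "untwist c \<nu> = a"
    by (rule untwist_surj[OF a, unfolded pa])
  have "\<nu> x = conjugate (s p) \<mu> x" for x
  proof (cases "x \<in> carrier \<Gamma>")
    case True
    have "\<nu> x \<otimes>\<^bsub>A\<^esub> s (c x) = conjugate (s p) \<mu> x \<otimes>\<^bsub>A\<^esub> s (c x)"
      using fun_cong[OF \<nu>(2), of x] True unfolding a_def conj_untwist[OF c p \<mu>, symmetric]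
      by (simp add: untwist_def)
    then show ?thesis
      using ZD_closed[OF \<nu>(1) True] ZP_closed[OF c True] ZD_closed[OF \<mu> True] pP True
      by (simp add: conjugate_def)
  next
    case False
    then show ?thesis
      using cocycle_undefined(3)[OF False \<nu>(1)] by (simp add: conjugate_def)
  qed
  then have eq: "\<nu> = conjugate (s p) \<mu>"
    by (rule ext)
  show ?thesis
    using \<nu>(1) unfolding eq .
qed

text \<open>The heart of the fibre count. If \<open>b\<close>, with permutation part
  \<open>p\<close>, relates two cocycles over the same \<open>c\<close>, then projecting the
  relation to \<open>P\<close> forces \<open>p\<close> to commute with all \<open>c x\<close>. The
  \<open>D\<close>-part of \<open>b\<close> then accounts for a coboundary in the twisted
  \<open>D\<close>.\<close>

lemma untwist_RA_iff:
  assumes c: "c \<in> ZP" and \<mu>: "\<mu> \<in> ZD c" and \<nu>: "\<nu> \<in> ZD c"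
  shows "(untwist c \<mu>, untwist c \<nu>) \<in> RA \<longleftrightarrow>
    (\<exists>p\<in>cocycle_centralizer \<Gamma> P c. (conjugate (s p) \<mu>, \<nu>) \<in> RD c)"
proof
  assume "(untwist c \<mu>, untwist c \<nu>) \<in> RA"
  then obtain b where b: "b \<in> carrier A" "\<And>x. x \<in> carrier \<Gamma> \<Longrightarrow>
      untwist c \<nu> x = inv\<^bsub>A\<^esub> b \<otimes>\<^bsub>A\<^esub> untwist c \<mu> x \<otimes>\<^bsub>A\<^esub> act x b"
    by (auto simp: RA_iff)
  obtain y p where yp: "y \<in> D" "p \<in> carrier P" "b = y \<otimes>\<^bsub>A\<^esub> s p"
    using b(1) decompose by blast
  have [simp]: "y \<in> carrier A"
    using yp by auto
  have "c x \<otimes>\<^bsub>P\<^esub> p \<otimes>\<^bsub>P\<^esub> inv\<^bsub>P\<^esub> c x = p" if x: "x \<in> carrier \<Gamma>" for x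
  proof -
    note mem = ZD_mem[OF \<mu> x] ZD_mem[OF \<nu> x] ZD_closed[OF \<mu> x] ZD_closed[OF \<nu> x] ZP_closed[OF c x]
    have "c x = pr (\<nu> x \<otimes>\<^bsub>A\<^esub> s (c x))"
      using mem by (simp add: pr_D)
    also have "\<nu> x \<otimes>\<^bsub>A\<^esub> s (c x) = inv\<^bsub>A\<^esub> b \<otimes>\<^bsub>A\<^esub> (\<mu> x \<otimes>\<^bsub>A\<^esub> s (c x)) \<otimes>\<^bsub>A\<^esub> act x b"
      using b(2)[OF x] x by (simp add: untwist_def)
    also have "pr \<dots> = inv\<^bsub>P\<^esub> p \<otimes>\<^bsub>P\<^esub> c x \<otimes>\<^bsub>P\<^esub> p"
      using mem yp b(1) x by (simp add: pr_D pr_act act_simps)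
    finally have "p \<otimes>\<^bsub>P\<^esub> c x = p \<otimes>\<^bsub>P\<^esub> (inv\<^bsub>P\<^esub> p \<otimes>\<^bsub>P\<^esub> c x \<otimes>\<^bsub>P\<^esub> p)"
      by simp
    also have "\<dots> = c x \<otimes>\<^bsub>P\<^esub> p"
      using mem yp by (simp add: P.m_assoc P.inv_mult_cancel_left)
    finally have "c x \<otimes>\<^bsub>P\<^esub> p = p \<otimes>\<^bsub>P\<^esub> c x" ..
    then show ?thesis
      using mem yp by (simp add: P.m_assoc)
  qed
  then have p: "p \<in> cocycle_centralizer \<Gamma> P c"
    using yp by (auto simp: cocycle_centralizer_def)
  \<comment> \<open>With this choice \<open>b\<close> is \<open>s p\<close> times \<open>z\<close>,
    so conjugation by \<open>s p\<close> comes first and \<open>z\<close> is the coboundary witness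
    afterwards.\<close>
  define z where "z = inv\<^bsub>A\<^esub> (s p) \<otimes>\<^bsub>A\<^esub> y \<otimes>\<^bsub>A\<^esub> s p"
  have z: "z \<in> D" "z \<in> carrier A"
    using yp by (auto simp: z_def intro!: D_conj)
  have "\<nu> x = inv\<^bsub>A\<^esub> z \<otimes>\<^bsub>A\<^esub> conjugate (s p) \<mu> x \<otimes>\<^bsub>A\<^esub>
      (s (c x) \<otimes>\<^bsub>A\<^esub> act x z \<otimes>\<^bsub>A\<^esub> inv\<^bsub>A\<^esub> (s (c x)))" if x: "x \<in> carrier \<Gamma>" for x
  proof -
    note mem = ZD_closed[OF \<mu> x] ZD_closed[OF \<nu> x] ZP_closed[OF c x]
    have comm: "s (c x) \<otimes>\<^bsub>A\<^esub> inv\<^bsub>A\<^esub> (s p) = inv\<^bsub>A\<^esub> (s p) \<otimes>\<^bsub>A\<^esub> s (c x)"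
    proof -
      have "s (c x) \<otimes>\<^bsub>A\<^esub> inv\<^bsub>A\<^esub> (s p) = inv\<^bsub>A\<^esub> (s p) \<otimes>\<^bsub>A\<^esub> (s p \<otimes>\<^bsub>A\<^esub> s (c x)) \<otimes>\<^bsub>A\<^esub> inv\<^bsub>A\<^esub> (s p)"
        using mem yp by (simp add: word_simps)
      also have "\<dots> = inv\<^bsub>A\<^esub> (s p) \<otimes>\<^bsub>A\<^esub> s (c x)"
        unfolding centralizer_commute(2)[OF c p x, symmetric] using mem yp by (simp add: word_simps)
      finally show ?thesis .
    qed
    have "\<nu> x = (\<nu> x \<otimes>\<^bsub>A\<^esub> s (c x)) \<otimes>\<^bsub>A\<^esub> inv\<^bsub>A\<^esub> (s (c x))"
      using mem by (simp add: word_simps)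
    also have "\<nu> x \<otimes>\<^bsub>A\<^esub> s (c x) = inv\<^bsub>A\<^esub> b \<otimes>\<^bsub>A\<^esub> (\<mu> x \<otimes>\<^bsub>A\<^esub> s (c x)) \<otimes>\<^bsub>A\<^esub> act x b"
      using b(2)[OF x] x by (simp add: untwist_def)
    \<comment> \<open>A cancelling pair of \<open>s p\<close> and its inverse is inserted. The first
      closes the conjugate of \<open>\<mu> x\<close>; the second commutes with
      \<open>s (c x)\<close> and then opens \<open>act x z\<close>.\<close>
    also have "\<dots> \<otimes>\<^bsub>A\<^esub> inv\<^bsub>A\<^esub> (s (c x)) = inv\<^bsub>A\<^esub> (s p) \<otimes>\<^bsub>A\<^esub> inv\<^bsub>A\<^esub> y \<otimes>\<^bsub>A\<^esub> \<mu> x \<otimes>\<^bsub>A\<^esub> s p \<otimes>\<^bsub>A\<^esub>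
        (inv\<^bsub>A\<^esub> (s p) \<otimes>\<^bsub>A\<^esub> s (c x)) \<otimes>\<^bsub>A\<^esub> act x y \<otimes>\<^bsub>A\<^esub> s p \<otimes>\<^bsub>A\<^esub> inv\<^bsub>A\<^esub> (s (c x))"
      using mem yp x by (simp add: act_simps act_s word_simps)
    also have "inv\<^bsub>A\<^esub> (s p) \<otimes>\<^bsub>A\<^esub> s (c x) = s (c x) \<otimes>\<^bsub>A\<^esub> inv\<^bsub>A\<^esub> (s p)"
      by (rule comm[symmetric])
    finally show ?thesis
      using mem yp x by (simp add: z_def conjugate_def act_simps act_s word_simps)
  qed
  then have "(conjugate (s p) \<mu>, \<nu>) \<in> RD c"
    unfolding RD_iff using conj_ZD[OF c p \<mu>] \<nu> z by blast
  then show "\<exists>p\<in>cocycle_centralizer \<Gamma> P c. (conjugate (s p) \<mu>, \<nu>) \<in> RD c"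
    using p by blast
next
  assume "\<exists>p\<in>cocycle_centralizer \<Gamma> P c. (conjugate (s p) \<mu>, \<nu>) \<in> RD c"
  then obtain p where p: "p \<in> cocycle_centralizer \<Gamma> P c" "(conjugate (s p) \<mu>, \<nu>) \<in> RD c"
    by blast
  then have pP: "p \<in> carrier P"
    by (auto simp: cocycle_centralizer_def)
  have \<mu>': "conjugate (s p) \<mu> \<in> ZD c"
    using conj_ZD[OF c p(1) \<mu>] .
  obtain b where b: "b \<in> D" "\<And>x. x \<in> carrier \<Gamma> \<Longrightarrow> \<nu> x = inv\<^bsub>A\<^esub> b \<otimes>\<^bsub>A\<^esub> conjugate (s p) \<mu> x \<otimes>\<^bsub>A\<^esub>
      (s (c x) \<otimes>\<^bsub>A\<^esub> act x b \<otimes>\<^bsub>A\<^esub> inv\<^bsub>A\<^esub> (s (c x)))"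
    using p(2) by (auto simp: RD_iff)
  have "untwist c \<nu> x = inv\<^bsub>A\<^esub> b \<otimes>\<^bsub>A\<^esub> untwist c (conjugate (s p) \<mu>) x \<otimes>\<^bsub>A\<^esub> act x b"
    if x: "x \<in> carrier \<Gamma>" for x
    using b x ZD_closed[OF \<mu>' x] ZP_closed[OF c x] 
    by (simp add: untwist_def act_simps word_simps)
  then have "(untwist c (conjugate (s p) \<mu>), untwist c \<nu>) \<in> RA"
    using b untwist_ZA(1)[OF c] \<mu>' \<nu> by (auto simp: RA_iff)
  moreover have "(untwist c \<mu>, untwist c (conjugate (s p) \<mu>)) \<in> RA"
    unfolding conj_untwist[OF c p(1) \<mu>] by (intro conj_ZA untwist_ZA c \<mu> pP)
  ultimately show "(untwist c \<mu>, untwist c \<nu>) \<in> RA"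
    by (rule RA_trans[rotated])
qed

lemma one_centralizer:
  assumes "c \<in> ZP"
  shows "\<one>\<^bsub>P\<^esub> \<in> cocycle_centralizer \<Gamma> P c"
  using ZP_closed[OF assms] by (auto simp: cocycle_centralizer_def)

lemma conj_one:
  assumes "\<mu> \<in> ZD c"
  shows "conjugate \<one>\<^bsub>A\<^esub> \<mu> = \<mu>"
proof
  fix x show "conjugate \<one>\<^bsub>A\<^esub> \<mu> x = \<mu> x"
    using assms ZD_closed[OF assms] by (cases "x \<in> carrier \<Gamma>") (auto simp: conjugate_def cocycle_undefined(3))
qed

text \<open>The case of \<open>untwist_RA_iff\<close> in which the centralizing permutation is the
  unit.\<close>

lemma RD_imp_untwist_RA:
  assumes c: "c \<in> ZP" and "(\<mu>, \<nu>) \<in> RD c"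
  shows "(untwist c \<mu>, untwist c \<nu>) \<in> RA"
proof -
  have "\<mu> \<in> ZD c" "\<nu> \<in> ZD c"
    using assms by (auto simp: RD_iff)
  then show ?thesis
    using assms(2) one_centralizer[OF c]
    by (subst untwist_RA_iff[OF c]) (auto intro!: bexI[of _ "\<one>\<^bsub>P\<^esub>"] simp: conj_one)
qed

text \<open>\<open>H1_conj\<close> is a union over all representatives of a class, so independence
  of the representative has to be shown. If \<open>b\<close> relates \<open>\<mu>\<close> to
  \<open>\<nu>\<close>, then its conjugate by \<open>s p\<close> relates their conjugates, since
  \<open>s p\<close> commutes with \<open>s (c x)\<close>.\<close>

lemma H1_conj_class:
  assumes c: "c \<in> ZP" and p: "p \<in> cocycle_centralizer \<Gamma> P c" and \<mu>: "\<mu> \<in> ZD c"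
  shows "H1_conj \<Gamma> T A D (twisted_act A act s c) (s p) (RD c `` {\<mu>}) = RD c `` {conjugate (s p) \<mu>}"
proof -
  have pP: "p \<in> carrier P"
    using p by (auto simp: cocycle_centralizer_def)
  have "RD c `` {conjugate (s p) \<nu>} = RD c `` {conjugate (s p) \<mu>}" if R: "(\<mu>, \<nu>) \<in> RD c" for \<nu>
  proof -
    have \<nu>: "\<nu> \<in> ZD c"
      using R by (auto simp: RD_iff)
    obtain b where b: "b \<in> D" "\<And>x. x \<in> carrier \<Gamma> \<Longrightarrow> \<nu> x = inv\<^bsub>A\<^esub> b \<otimes>\<^bsub>A\<^esub> \<mu> x \<otimes>\<^bsub>A\<^esub>
        (s (c x) \<otimes>\<^bsub>A\<^esub> act x b \<otimes>\<^bsub>A\<^esub> inv\<^bsub>A\<^esub> (s (c x)))"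
      using R by (auto simp: RD_iff)
    define z where "z = inv\<^bsub>A\<^esub> (s p) \<otimes>\<^bsub>A\<^esub> b \<otimes>\<^bsub>A\<^esub> s p"
    have z: "z \<in> D" "z \<in> carrier A"
      using b pP by (auto simp: z_def intro!: D_conj)
    have "conjugate (s p) \<nu> x = inv\<^bsub>A\<^esub> z \<otimes>\<^bsub>A\<^esub> conjugate (s p) \<mu> x \<otimes>\<^bsub>A\<^esub>
        (s (c x) \<otimes>\<^bsub>A\<^esub> act x z \<otimes>\<^bsub>A\<^esub> inv\<^bsub>A\<^esub> (s (c x)))" if x: "x \<in> carrier \<Gamma>" for x
    proof -
      note mem = ZD_closed[OF \<mu> x] ZP_closed[OF c x] D.mem_carrier[OF b(1)]
      have comm: "s (c x) \<otimes>\<^bsub>A\<^esub> inv\<^bsub>A\<^esub> (s p) = inv\<^bsub>A\<^esub> (s p) \<otimes>\<^bsub>A\<^esub> s (c x)"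
        "inv\<^bsub>A\<^esub> (s (c x)) \<otimes>\<^bsub>A\<^esub> s p = s p \<otimes>\<^bsub>A\<^esub> inv\<^bsub>A\<^esub> (s (c x))"
        using centralizer_commute(2)[OF c p x] mem pP
        by (metis A.inv_closed A.inv_solve_left' A.inv_solve_right' A.m_assoc A.m_closed s.hom_closed)+
      have "conjugate (s p) \<nu> x = inv\<^bsub>A\<^esub> (s p) \<otimes>\<^bsub>A\<^esub> inv\<^bsub>A\<^esub> b \<otimes>\<^bsub>A\<^esub> \<mu> x \<otimes>\<^bsub>A\<^esub> 
          s (c x) \<otimes>\<^bsub>A\<^esub> act x b \<otimes>\<^bsub>A\<^esub> (inv\<^bsub>A\<^esub> (s (c x)) \<otimes>\<^bsub>A\<^esub> s p)"
        using mem x pP b(2)[OF x] by (simp add: conjugate_def act_simps word_simps)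
      also have "\<dots> = inv\<^bsub>A\<^esub> (s p) \<otimes>\<^bsub>A\<^esub> inv\<^bsub>A\<^esub> b \<otimes>\<^bsub>A\<^esub> \<mu> x \<otimes>\<^bsub>A\<^esub> s p \<otimes>\<^bsub>A\<^esub> 
          (inv\<^bsub>A\<^esub> (s p) \<otimes>\<^bsub>A\<^esub> s (c x)) \<otimes>\<^bsub>A\<^esub> act x b \<otimes>\<^bsub>A\<^esub> (s p \<otimes>\<^bsub>A\<^esub> inv\<^bsub>A\<^esub> (s (c x)))"
        unfolding comm(2) using mem x pP by (simp add: act_simps word_simps)
      also have "\<dots> = inv\<^bsub>A\<^esub> (s p) \<otimes>\<^bsub>A\<^esub> inv\<^bsub>A\<^esub> b \<otimes>\<^bsub>A\<^esub> \<mu> x \<otimes>\<^bsub>A\<^esub> s p \<otimes>\<^bsub>A\<^esub> 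
          (s (c x) \<otimes>\<^bsub>A\<^esub> inv\<^bsub>A\<^esub> (s p)) \<otimes>\<^bsub>A\<^esub> act x b \<otimes>\<^bsub>A\<^esub> (s p \<otimes>\<^bsub>A\<^esub> inv\<^bsub>A\<^esub> (s (c x)))"
        unfolding comm(1) ..
      finally show ?thesis
        using mem x pP by (simp add: z_def conjugate_def act_simps act_s word_simps)
    qed
    then have "(conjugate (s p) \<mu>, conjugate (s p) \<nu>) \<in> RD c"
      unfolding RD_iff using conj_ZD[OF c p] \<mu> \<nu> z by blast
    then show ?thesis
      using equiv_class_eq[OF equiv_RD[OF c]] by metis
  qed
  moreover have "(\<mu>, \<mu>) \<in> RD c"
    using RD_refl[OF c \<mu>] .
  ultimately show ?thesis
    unfolding H1_conj_def conjugate_def[symmetric] by blast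
qed

text \<open>By \<open>untwist_RA_iff\<close> the orbit relation is the relation \<open>RA\<close>
  seen through \<open>untwist\<close>. Equality of orbits can thus be decided with the equivalence
  relation \<open>RA\<close>.\<close>

lemma orbit_class:
  assumes c: "c \<in> ZP" and \<mu>: "\<mu> \<in> ZD c"
  shows "orbit (P\<lparr>carrier := cocycle_centralizer \<Gamma> P c\<rparr>)
      (\<lambda>p. H1_conj \<Gamma> T A D (twisted_act A act s c) (s p)) (RD c `` {\<mu>}) =
    {RD c `` {\<nu>} | \<nu>. \<nu> \<in> ZD c \<and> (untwist c \<mu>, untwist c \<nu>) \<in> RA}"
proof -
  have "\<exists>\<nu>. RD c `` {conjugate (s p) \<mu>} = RD c `` {\<nu>} \<and> \<nu> \<in> ZD c \<and> (untwist c \<mu>, untwist c \<nu>) \<in> RA"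
    if p: "p \<in> cocycle_centralizer \<Gamma> P c" for p
  proof (intro exI[of _ "conjugate (s p) \<mu>"] conjI refl)
    show "conjugate (s p) \<mu> \<in> ZD c"
      using conj_ZD[OF c p \<mu>] .
    then show "(untwist c \<mu>, untwist c (conjugate (s p) \<mu>)) \<in> RA"
      using untwist_RA_iff[OF c \<mu>] p RD_refl[OF c] by blast
  qed
  moreover have "\<exists>p\<in>cocycle_centralizer \<Gamma> P c. RD c `` {\<nu>} = RD c `` {conjugate (s p) \<mu>}"
    if "\<nu> \<in> ZD c" "(untwist c \<mu>, untwist c \<nu>) \<in> RA" for \<nu>
    using untwist_RA_iff[OF c \<mu> that(1)] that(2) equiv_class_eq[OF equiv_RD[OF c]] by blast
  moreover have "orbit (P\<lparr>carrier := cocycle_centralizer \<Gamma> P c\<rparr>)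
      (\<lambda>p. H1_conj \<Gamma> T A D (twisted_act A act s c) (s p)) (RD c `` {\<mu>}) =
    {RD c `` {conjugate (s p) \<mu>} | p. p \<in> cocycle_centralizer \<Gamma> P c}"
    unfolding orbit_def by (intro Collect_cong ex_cong1) (auto simp: H1_conj_class[OF c _ \<mu>])
  moreover have "{RD c `` {conjugate (s p) \<mu>} | p. p \<in> cocycle_centralizer \<Gamma> P c} =
    {RD c `` {\<nu>} | \<nu>. \<nu> \<in> ZD c \<and> (untwist c \<mu>, untwist c \<nu>) \<in> RA}"
    using calculation(1,2) by (intro equalityI subsetI; elim CollectE exE conjE; simp) blast+
  ultimately show ?thesis
    by (simp only:)
qed

text \<open>Serre's description of the fibre of \<open>H\<^sup>1(\<Gamma>, A) \<rightarrow> H\<^sup>1(\<Gamma>, P)\<close> over the class of \<open>c\<close>.\<close>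

lemma ecard_twisted_H1_orbits:
  assumes c: "c \<in> ZP"
  shows "ecard (twisted_H1_orbits \<Gamma> T A act D P s c) = ecard ((\<lambda>\<mu>. RA `` {untwist c \<mu>}) ` ZD c)"
proof -
  define orb where "orb \<mu> = orbit (P\<lparr>carrier := cocycle_centralizer \<Gamma> P c\<rparr>)
      (\<lambda>p. H1_conj \<Gamma> T A D (twisted_act A act s c) (s p)) (RD c `` {\<mu>})" for \<mu>
  have "twisted_H1_orbits \<Gamma> T A act D P s c = orb ` ZD c"
    by (auto simp: twisted_H1_orbits_def orbits_def H1_def quotient_def orb_def)
  moreover have "orb \<mu> = orb \<nu> \<longleftrightarrow> RA `` {untwist c \<mu>} = RA `` {untwist c \<nu>}"
    if \<mu>: "\<mu> \<in> ZD c" and \<nu>: "\<nu> \<in> ZD c" for \<mu> \<nu>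
  proof
    assume eq: "orb \<mu> = orb \<nu>"
    have "(untwist c \<nu>, untwist c \<nu>) \<in> RA"
      by (intro RA_refl untwist_ZA(1) c \<nu>)
    then have "RD c `` {\<nu>} \<in> orb \<mu>"
      unfolding eq using orbit_class[OF c \<nu>] \<nu> by (auto simp: orb_def)
    then obtain \<nu>' where "(untwist c \<mu>, untwist c \<nu>') \<in> RA" "RD c `` {\<nu>} = RD c `` {\<nu>'}" "\<nu>' \<in> ZD c"
      using orbit_class[OF c \<mu>] by (auto simp: orb_def)
    moreover from this have "(untwist c \<nu>, untwist c \<nu>') \<in> RA"
      using RD_imp_untwist_RA[OF c] eq_equiv_class[OF _ equiv_RD[OF c]] by metis
    ultimately show "RA `` {untwist c \<mu>} = RA `` {untwist c \<nu>}"
      using equiv_class_eq[OF equiv_RA] by metis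
  next
    assume "RA `` {untwist c \<mu>} = RA `` {untwist c \<nu>}"
    then have "(untwist c \<mu>, \<alpha>) \<in> RA \<longleftrightarrow> (untwist c \<nu>, \<alpha>) \<in> RA" for \<alpha>
      by blast
    then show "orb \<mu> = orb \<nu>"
      unfolding orb_def orbit_class[OF c \<mu>] orbit_class[OF c \<nu>] by simp
  qed
  ultimately show ?thesis
    using ecard_image_eq[of "ZD c" orb "\<lambda>\<mu>. RA `` {untwist c \<mu>}"] by simp
qed

text \<open>The fibres over the classes of \<open>P\<close> partition \<open>H1\<close> of
  \<open>A\<close>: they are disjoint because the projection respects cohomology, and they cover
  because every class contains a cocycle that projects exactly to the chosen representative.\<close>

theorem ecard_H1_semidirect:
  assumes fin: "finite (H1 \<Gamma> T P trivial_act)"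
    and rep: "\<forall>C\<in>H1 \<Gamma> T P trivial_act. rep C \<in> C"
  shows "ecard (H1 \<Gamma> T A act) =
    (\<Sum>C\<in>H1 \<Gamma> T P trivial_act. ecard (twisted_H1_orbits \<Gamma> T A act D P s (rep C)))"
proof -
  define fib where "fib C = (\<lambda>\<mu>. RA `` {untwist (rep C) \<mu>}) ` ZD (rep C)" for C
  have repZ: "rep C \<in> ZP" "C = RP `` {rep C}" if "C \<in> H1 \<Gamma> T P trivial_act" for C
  proof -
    have C: "C \<in> ZP // RP" "rep C \<in> C"
      using that rep by (auto simp: H1_def)
    then show "rep C \<in> ZP"
      using in_quotient_imp_subset[OF equiv_RP] by blast
    show "C = RP `` {rep C}"
      using C(1)
    proof (rule quotientE)
      fix c assume "C = RP `` {c}"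
      then show ?thesis
        using C(2) equiv_class_eq[OF equiv_RP, of c "rep C"] by simp
    qed
  qed
  have disj: "fib C \<inter> fib C' = {}"
    if "C \<in> H1 \<Gamma> T P trivial_act" "C' \<in> H1 \<Gamma> T P trivial_act" "C \<noteq> C'" for C C'
  proof (rule ccontr)
    assume "fib C \<inter> fib C' \<noteq> {}"
    then obtain \<mu> \<mu>' where \<mu>: "\<mu> \<in> ZD (rep C)" "\<mu>' \<in> ZD (rep C')"
      and "RA `` {untwist (rep C) \<mu>} = RA `` {untwist (rep C') \<mu>'}"
      by (auto simp: fib_def)
    then have "(untwist (rep C) \<mu>, untwist (rep C') \<mu>') \<in> RA"
      using eq_equiv_class[OF _ equiv_RA] untwist_ZA(1) repZ that by blast
    then have "(rep C, rep C') \<in> RP"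
      using project_RP untwist_ZA(2)[OF repZ(1) \<mu>(1)] untwist_ZA(2)[OF repZ(1) \<mu>(2)] that by fastforce
    then have "RP `` {rep C} = RP `` {rep C'}"
      by (rule equiv_class_eq[OF equiv_RP])
    then show False
      using repZ(2) that by simp
  qed
  have "H1 \<Gamma> T A act = (\<Union>C\<in>H1 \<Gamma> T P trivial_act. fib C)"
  proof safe
    fix h assume "h \<in> H1 \<Gamma> T A act"
    then obtain a where a: "a \<in> ZA" "h = RA `` {a}"
      by (auto simp: H1_def quotient_def)
    define C where "C = RP `` {project a}"
    have C: "C \<in> H1 \<Gamma> T P trivial_act"
      using project_ZP[OF a(1)] by (auto simp: C_def H1_def quotient_def)
    then have "(project a, rep C) \<in> RP"
      using rep by (auto simp: C_def)
    then obtain p where p: "p \<in> carrier P" "\<And>x. x \<in> carrier \<Gamma> \<Longrightarrow>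
        rep C x = inv\<^bsub>P\<^esub> p \<otimes>\<^bsub>P\<^esub> project a x \<otimes>\<^bsub>P\<^esub> p"
      by (auto simp: cohomologous_def trivial_act_def)
    \<comment> \<open>The element \<open>p\<close> carries \<open>project a\<close> to
      \<open>rep C\<close>; lifted to \<open>s p\<close>, it moves \<open>a\<close> inside its own
      class.\<close>
    define a' where "a' = conjugate (s p) a"
    have a': "(a, a') \<in> RA"
      unfolding a'_def using a p by (intro conj_ZA)
    then have "a' \<in> ZA"
      by (simp add: RA_iff)
    have "project a' x = rep C x" for x
      using p ZA_closed[OF a(1)] repZ(1)[OF C]
      by (cases "x \<in> carrier \<Gamma>") (auto simp: project_def a'_def conjugate_def cocycle_undefined(1))
    then have pa': "project a' = rep C"
      by (rule ext)
    obtain \<mu> where "\<mu> \<in> ZD (rep C)" "untwist (rep C) \<mu> = a'"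
      by (rule untwist_surj[OF \<open>a' \<in> ZA\<close>, unfolded pa'])
    then have "h \<in> fib C"
      unfolding fib_def a(2) using equiv_class_eq[OF equiv_RA a'] by blast
    then show "h \<in> (\<Union>C\<in>H1 \<Gamma> T P trivial_act. fib C)"
      using C by blast
  next
    fix h C assume "C \<in> H1 \<Gamma> T P trivial_act" "h \<in> fib C"
    then show "h \<in> H1 \<Gamma> T A act"
      using untwist_ZA(1)[OF repZ(1)] by (auto simp: fib_def H1_def quotient_def)
  qed
  then show ?thesis
    using ecard_UN_disjoint[OF fin disj] ecard_twisted_H1_orbits repZ(1) by (simp add: fib_def)
qed

end


section \<open>Ring homomorphisms and polynomials\<close>

text \<open>Covers Galois automorphisms, powers of the Frobenius, the embedding
  \<open>to_ac\<close>, and the map from \<open>complex\<close> into the closure of a copy of the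
  reals.\<close>

locale type_ring_hom =
  fixes f :: "'a::field \<Rightarrow> 'b::field"
  assumes hom_add: "f (x + y) = f x + f y"
    and hom_mult: "f (x * y) = f x * f y"
    and hom_one: "f 1 = 1"
begin

lemma hom_zero: "f 0 = 0"
  by (metis add.right_neutral add_left_imp_eq hom_add)

lemma hom_uminus: "f (- x) = - f x"
  using hom_add[of x "- x"] hom_zero by (simp add: eq_neg_iff_add_eq_0 add.commute)

lemma hom_diff: "f (x - y) = f x - f y"
  using hom_add[of x "- y"] by (simp add: hom_uminus)

lemma hom_eq_0_iff: "f x = 0 \<longleftrightarrow> x = 0"
proof
  assume "f x = 0"
  then have "f (x * inverse x) = 0"
    by (simp add: hom_mult)
  then show "x = 0"
    using hom_one by (cases "x = 0") auto
qed (simp add: hom_zero)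

lemma hom_inj: "inj f"
  using hom_diff hom_eq_0_iff by (metis injI right_minus_eq)

lemma hom_inverse: "f (inverse x) = inverse (f x)"
proof (cases "x = 0")
  case False
  have "f x * f (inverse x) = 1"
    using False by (simp add: hom_mult[symmetric] hom_one)
  then show ?thesis
    by (simp add: inverse_unique)
qed (simp add: hom_zero)

lemma hom_power: "f (x ^ n) = f x ^ n"
  by (induction n) (simp_all add: hom_mult hom_one)

lemma hom_sum: "f (\<Sum>i\<in>I. g i) = (\<Sum>i\<in>I. f (g i))"
  by (induction I rule: infinite_finite_induct) (simp_all add: hom_add hom_zero)

lemma hom_prod: "f (\<Prod>i\<in>I. g i) = (\<Prod>i\<in>I. f (g i))"
  by (induction I rule: infinite_finite_induct) (simp_all add: hom_mult hom_one)

lemma hom_poly: "f (poly p x) = poly (map_poly f p) (f x)"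
  by (induction p) (simp_all add: map_poly_pCons hom_zero hom_add hom_mult)

lemma map_poly_hom_mult: "map_poly f (p * q) = map_poly f p * map_poly f q"
  by (rule poly_eqI) (simp add: coeff_map_poly hom_zero coeff_mult hom_sum hom_mult)

lemma map_poly_hom_prod: "map_poly f (\<Prod>i\<in>I. g i) = (\<Prod>i\<in>I. map_poly f (g i))"
  by (induction I rule: infinite_finite_induct) (simp_all add: map_poly_hom_mult hom_one)

lemma map_poly_hom_linear: "map_poly f [:- a, 1:] = [:- f a, 1:]"
  by (simp add: map_poly_pCons hom_zero hom_one hom_uminus)

end


section \<open>The absolute Galois group\<close>

abbreviation gal :: "('k::field alg_closure \<Rightarrow> 'k alg_closure) monoid" where
  "gal \<equiv> galois_group (to_ac :: 'k \<Rightarrow> 'k alg_closure)"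

abbreviation krull :: "('k::field alg_closure \<Rightarrow> 'k alg_closure) topology" where
  "krull \<equiv> krull_topology (to_ac :: 'k \<Rightarrow> 'k alg_closure)"

lemma gal_hom:
  assumes "\<sigma> \<in> carrier gal"
  shows "type_ring_hom \<sigma>"
proof
  have "\<sigma> (to_ac 1) = to_ac 1"
    using assms unfolding galois_group_def by (simp del: to_ac_1)
  then show "\<sigma> 1 = 1"
    by simp
qed (use assms in \<open>simp_all add: galois_group_def\<close>)

lemma gal_bij: "\<sigma> \<in> carrier gal \<Longrightarrow> bij \<sigma>"
  by (simp add: galois_group_def)

lemma gal_to_ac: "\<sigma> \<in> carrier gal \<Longrightarrow> \<sigma> (to_ac a) = to_ac a"
  by (simp add: galois_group_def)

lemma gal_mult: "\<sigma> \<otimes>\<^bsub>gal\<^esub> \<tau> = \<sigma> \<circ> \<tau>"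
  by (simp add: galois_group_def)

lemma gal_id: "id \<in> carrier gal"
  by (simp add: galois_group_def)

lemma gal_comp: "\<sigma> \<in> carrier gal \<Longrightarrow> \<tau> \<in> carrier gal \<Longrightarrow> \<sigma> \<circ> \<tau> \<in> carrier gal"
  by (auto simp: galois_group_def bij_comp)

lemma gal_inv:
  assumes "\<sigma> \<in> carrier gal"
  shows "inv_into UNIV \<sigma> \<in> carrier gal"
proof -
  interpret type_ring_hom \<sigma>
    using gal_hom[OF assms] .
  note b = gal_bij[OF assms]
  have i: "inv_into UNIV \<sigma> y = x \<longleftrightarrow> y = \<sigma> x" for x y
    using b by (metis bij_inv_eq_iff)
  have "\<sigma> (inv_into UNIV \<sigma> x) = x" for x
    using b by (simp add: bij_is_surj surj_f_inv_f)
  then show ?thesis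
    using b by (simp add: galois_group_def bij_imp_bij_inv i hom_add hom_mult gal_to_ac[OF assms])
qed

lemma module_to_ac: "Modules.module (\<lambda>a x. to_ac a * x)"
  by unfold_locales (simp_all add: algebra_simps)

lemma gal_eq_on_span:
  assumes "\<sigma> \<in> carrier gal" "\<tau> \<in> carrier gal" "\<And>x. x \<in> B \<Longrightarrow> \<sigma> x = \<tau> x"
    and "x \<in> module.span (\<lambda>a x. to_ac a * x) B"
  shows "\<sigma> x = \<tau> x"
proof -
  interpret \<sigma>: type_ring_hom \<sigma>
    using gal_hom[OF assms(1)] .
  interpret \<tau>: type_ring_hom \<tau>
    using gal_hom[OF assms(2)] .
  interpret Modules.module "\<lambda>a x. to_ac a * x"
    by (rule module_to_ac)
  show ?thesis
    using assms(4)
  proof (induction rule: span_induct_alt)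
    case base
    then show ?case
      by (simp add: \<sigma>.hom_zero \<tau>.hom_zero)
  next
    case (step c x y)
    then show ?case
      by (simp add: \<sigma>.hom_add \<tau>.hom_add \<sigma>.hom_mult \<tau>.hom_mult assms gal_to_ac)
  qed
qed

lemma topspace_krull: "topspace (krull :: ('k::field alg_closure \<Rightarrow> 'k alg_closure) topology) = carrier gal"
proof
  show "topspace (krull :: ('k alg_closure \<Rightarrow> 'k alg_closure) topology) \<subseteq> carrier gal"
    by (auto simp: krull_topology_def l_coset_def gal_mult gal_comp)
  interpret Modules.module "\<lambda>(a::'k) x. to_ac a * x"
    by (rule module_to_ac)
  \<comment> \<open>The base field itself serves as finite subextension, so every automorphism lies
    in a member of the generating family.\<close>
  have "range (to_ac :: 'k \<Rightarrow> _) = span {1}"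
    by (auto simp: span_breakdown_eq)
  moreover have "x - y \<in> range to_ac \<and> x * y \<in> range to_ac \<and> inverse x \<in> range to_ac"
    if "x \<in> range (to_ac :: 'k \<Rightarrow> _)" "y \<in> range (to_ac :: 'k \<Rightarrow> _)" for x y
    using that by (auto simp flip: to_ac_diff to_ac_mult to_ac_inverse)
  ultimately have fin: "finite_subextension to_ac (range (to_ac :: 'k \<Rightarrow> _))"
    unfolding finite_subextension_def by (intro conjI ballI subset_refl exI[of _ "{1}"]) auto
  show "carrier gal \<subseteq> topspace (krull :: ('k alg_closure \<Rightarrow> 'k alg_closure) topology)"
  proof
    fix \<sigma> :: "'k alg_closure \<Rightarrow> 'k alg_closure" assume \<sigma>: "\<sigma> \<in> carrier gal"
    have "\<sigma> \<in> \<sigma> <#\<^bsub>gal\<^esub> {\<tau> \<in> carrier gal. \<forall>x\<in>range (to_ac :: 'k \<Rightarrow> _). \<tau> x = x}"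
      by (auto simp: l_coset_def gal_mult gal_id intro!: exI[of _ id])
    then show "\<sigma> \<in> topspace (krull :: ('k alg_closure \<Rightarrow> 'k alg_closure) topology)"
      using \<sigma> fin unfolding krull_topology_def topology_generated_by_topspace by blast
  qed
qed

text \<open>A generating set is a coset of the pointwise stabilizer of some \<open>L\<close>, and
  membership depends only on the values on a finite spanning set of \<open>L\<close>. Finite
  intersections merge these finite sets. This form turns density into interpolation at finitely many
  elements.\<close>

lemma krull_open_nbhd:
  assumes "openin (krull :: ('k::field alg_closure \<Rightarrow> 'k alg_closure) topology) U" "\<sigma> \<in> U"
  shows "\<exists>B. finite B \<and> (\<forall>\<tau>\<in>carrier gal. (\<forall>x\<in>B. \<tau> x = \<sigma> x) \<longrightarrow> \<tau> \<in> U)"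
  using assms(1)[unfolded krull_topology_def, THEN openin_topology_generated_by] assms(2)
proof (induction arbitrary: \<sigma>)
  case (Int U W)
  obtain B where B: "finite B" "\<forall>\<tau>\<in>carrier gal. (\<forall>x\<in>B. \<tau> x = \<sigma> x) \<longrightarrow> \<tau> \<in> U"
    using Int.IH(1)[of \<sigma>] Int.prems by blast
  obtain C where C: "finite C" "\<forall>\<tau>\<in>carrier gal. (\<forall>x\<in>C. \<tau> x = \<sigma> x) \<longrightarrow> \<tau> \<in> W"
    using Int.IH(2)[of \<sigma>] Int.prems by blast
  show ?case
    using B C by (intro exI[of _ "B \<union> C"]) blast
next
  case (UN \<U>)
  then obtain W where W: "W \<in> \<U>" "\<sigma> \<in> W"
    by blast
  then obtain B where "finite B" "\<forall>\<tau>\<in>carrier gal. (\<forall>x\<in>B. \<tau> x = \<sigma> x) \<longrightarrow> \<tau> \<in> W"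
    using UN.IH[of W \<sigma>] by blast
  with W show ?case
    by blast
next
  case (Basis U)
  then obtain \<rho> L where \<rho>: "\<rho> \<in> carrier gal" and L: "finite_subextension to_ac L"
    and U: "U = \<rho> <#\<^bsub>gal\<^esub> {\<tau> \<in> carrier gal. \<forall>x\<in>L. \<tau> x = x}"
    by auto
  obtain \<eta> where \<eta>: "\<eta> \<in> carrier gal" "\<And>x. x \<in> L \<Longrightarrow> \<eta> x = x" and \<sigma>: "\<sigma> = \<rho> \<circ> \<eta>"
    using Basis.prems by (auto simp: U l_coset_def gal_mult)
  obtain B where B: "finite B" "L = module.span (\<lambda>a x. to_ac a * x) B"
    using L by (auto simp: finite_subextension_def)
  have "\<tau> \<in> U" if \<tau>: "\<tau> \<in> carrier gal" "\<forall>x\<in>B. \<tau> x = \<sigma> x" for \<tau>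
  proof -
    have "\<tau> x = \<rho> x" if "x \<in> L" for x
      using gal_eq_on_span[of \<tau> \<sigma> B x] that \<tau> \<sigma> \<eta> \<rho> B by (auto simp: gal_comp)
    then have "inv_into UNIV \<rho> (\<tau> x) = x" if "x \<in> L" for x
      using that gal_bij[OF \<rho>] by (simp add: bij_is_inj)
    moreover have "\<rho> (inv_into UNIV \<rho> (\<tau> x)) = \<tau> x" for x
      using gal_bij[OF \<rho>] by (simp add: bij_is_surj surj_f_inv_f)
    \<comment> \<open>The factor in the coset is the inverse of \<open>\<rho>\<close> composed with
      \<open>\<tau>\<close>, which fixes \<open>L\<close> pointwise.\<close>
    ultimately show ?thesis
      using \<rho> \<tau> by (auto simp: U l_coset_def gal_mult gal_comp gal_inv fun_eq_iff
          intro!: exI[of _ "inv_into UNIV \<rho> \<circ> \<tau>"])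
  qed
  then show ?case
    using B by blast
qed simp


section \<open>Real base field\<close>

lemma to_ac_hom: "type_ring_hom to_ac"
  by unfold_locales simp_all

text \<open>The closure consists of the \<open>g z\<close>, that is, it is generated over the base
  by a square root of \<open>-1\<close>. An automorphism is therefore determined by the image of
  that root, for which there are two candidates.\<close>

lemma finite_gal_real:
  fixes f :: "'k::field \<Rightarrow> real"
  assumes bij: "bij f" and add: "\<And>x y. f (x + y) = f x + f y" and mult: "\<And>x y. f (x * y) = f x * f y"
  shows "finite (carrier (gal :: ('k alg_closure \<Rightarrow> 'k alg_closure) monoid))"
proof -
  interpret f: type_ring_hom f
  proof
    have "f 0 = 0"
      using add[of 0 0] by simp
    then have "f 1 \<noteq> 0"
      using bij by (metis bij_pointE zero_neq_one)
    then show "f 1 = 1"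
      using mult[of 1 1] by simp
  qed (fact add mult)+
  define r where "r = inv_into UNIV f"
  have fr: "f (r x) = x" and rf: "r (f y) = y" for x y
    using bij by (simp_all add: r_def bij_is_inj bij_is_surj surj_f_inv_f)
  have r: "r (x + y) = r x + r y" "r (x * y) = r x * r y" "r 1 = 1" "r (x - y) = r x - r y" for x y
    using fr f.hom_add f.hom_mult f.hom_one f.hom_diff by (metis rf)+
  obtain \<i>' :: "'k alg_closure" where I: "\<i>'\<^sup>2 = - 1"
    using nth_root_exists[of 2 "- 1"] by auto
  define g where "g z = to_ac (r (Re z)) + to_ac (r (Im z)) * \<i>'" for z
  interpret g: type_ring_hom g
  proof
    fix x y
    show "g (x + y) = g x + g y"
      by (simp add: g_def r algebra_simps)
    have "g x * g y = to_ac (r (Re x)) * to_ac (r (Re y)) + to_ac (r (Im x)) * to_ac (r (Im y)) * \<i>'\<^sup>2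
        + (to_ac (r (Re x)) * to_ac (r (Im y)) + to_ac (r (Im x)) * to_ac (r (Re y))) * \<i>'"
      by (simp add: g_def algebra_simps power2_eq_square)
    then show "g (x * y) = g x * g y"
      unfolding I by (simp add: g_def r algebra_simps)
    have "r 0 = 0"
      using rf[of 0] f.hom_zero by simp
    then show "g 1 = 1"
      by (simp add: g_def r)
  qed
  have r0: "r 0 = 0"
    using rf[of 0] f.hom_zero by simp
  have g_surj: "\<exists>z. x = g z" for x
  proof -
    \<comment> \<open>A polynomial over the base that kills \<open>x\<close> is transported to
      \<open>complex\<close>, where it splits; \<open>g\<close> carries the linear factors back, so
      \<open>x\<close> is the image of a complex root.\<close>
    obtain p :: "'k poly" where p: "p \<noteq> 0" "poly (map_poly to_ac p) x = 0"
      by (rule alg_closure_algebraic)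
    define q where "q = map_poly (\<lambda>a. complex_of_real (f a)) p"
    have "q \<noteq> 0"
      using p(1) by (simp add: q_def map_poly_eq_0_iff f.hom_zero f.hom_eq_0_iff)
    have "map_poly g q = map_poly to_ac p"
      by (rule poly_eqI) (simp add: q_def coeff_map_poly f.hom_zero g.hom_zero g_def rf r0)
    obtain z where z: "Polynomial.smult (Polynomial.lead_coeff q) (\<Prod>i<Polynomial.degree q. [:- z i, 1:]) = q"
      by (rule complex_poly_decompose')
    have "map_poly to_ac p = map_poly g (Polynomial.smult (Polynomial.lead_coeff q) (\<Prod>i<Polynomial.degree q. [:- z i, 1:]))"
      unfolding z by (rule \<open>map_poly g q = map_poly to_ac p\<close>[symmetric])
    also have "\<dots> = Polynomial.smult (g (Polynomial.lead_coeff q)) (\<Prod>i<Polynomial.degree q. [:- g (z i), 1:])"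
      by (simp only: map_poly_smult g.hom_zero g.hom_mult g.map_poly_hom_prod g.map_poly_hom_linear)
    finally have "g (Polynomial.lead_coeff q) * (\<Prod>i<Polynomial.degree q. x - g (z i)) = 0"
      using p(2) by (simp add: poly_prod)
    then show ?thesis
      using \<open>q \<noteq> 0\<close> by (auto simp: g.hom_eq_0_iff)
  qed
  have "inj_on (\<lambda>\<sigma>. \<sigma> \<i>') (carrier gal)"
  proof (intro inj_onI ext)
    fix \<sigma> \<tau> x assume \<sigma>: "\<sigma> \<in> carrier gal" and \<tau>: "\<tau> \<in> carrier gal" and eq: "\<sigma> \<i>' = \<tau> \<i>'"
    interpret \<sigma>: type_ring_hom \<sigma>
      using gal_hom[OF \<sigma>] .
    interpret \<tau>: type_ring_hom \<tau>
      using gal_hom[OF \<tau>] .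
    obtain z where "x = g z"
      using g_surj by blast
    then show "\<sigma> x = \<tau> x"
      by (simp add: g_def \<sigma>.hom_add \<tau>.hom_add \<sigma>.hom_mult \<tau>.hom_mult eq gal_to_ac[OF \<sigma>] gal_to_ac[OF \<tau>])
  qed
  moreover have "(\<lambda>\<sigma>. \<sigma> \<i>') ` carrier gal \<subseteq> {\<i>', - \<i>'}"
  proof safe
    fix \<sigma> assume "\<sigma> \<in> carrier gal" and ne: "\<sigma> \<i>' \<noteq> \<i>'"
    then interpret \<sigma>: type_ring_hom \<sigma>
      using gal_hom by blast
    have "(\<sigma> \<i>')\<^sup>2 = \<i>'\<^sup>2"
      by (simp add: \<sigma>.hom_power[symmetric] I \<sigma>.hom_uminus \<sigma>.hom_one)
    then show "\<sigma> \<i>' = - \<i>'"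
      using ne by (simp add: power2_eq_iff)
  qed
  ultimately show ?thesis
    by (meson finite.emptyI finite.insertI finite_imageD finite_subset)
qed


section \<open>Finite base field\<close>

lemma power_card_UNIV_eq:
  fixes x :: "'k::field"
  assumes fin: "finite (UNIV :: 'k set)"
  shows "x ^ CARD('k) = x"
proof (cases "x = 0")
  case False
  let ?U = "UNIV - {0 :: 'k}"
  have "inj_on ((*) x) ?U"
    using False by (auto intro!: inj_onI)
  moreover from this have "(*) x ` ?U = ?U"
    using False fin by (intro endo_inj_surj) auto
  ultimately have "prod id ?U = (\<Prod>y\<in>?U. x * y)"
    by (metis (no_types, lifting) id_apply prod.cong prod.reindex comp_def)
  also have "\<dots> = x ^ card ?U * prod id ?U"
    by (simp add: prod.distrib)
  finally have "x ^ card ?U = 1"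
    using fin by simp
  moreover have "CARD('k) = Suc (card ?U)"
    using fin by (metis UNIV_I card_Suc_Diff1)
  ultimately show ?thesis
    by (simp only: power_Suc mult_1_right)
qed (use fin in \<open>simp add: finite_UNIV_card_ge_0\<close>)

text \<open>The shift by one permutes the field. Comparing the sums of all elements before and after
  shows that the cardinality vanishes in the field.\<close>

lemma CHAR_dvd_CARD_field:
  assumes fin: "finite (UNIV :: 'k::field set)"
  shows "CHAR('k) dvd CARD('k)"
proof -
  have "(\<Sum>x\<in>UNIV. x) = (\<Sum>x\<in>UNIV. x + (1::'k))"
    by (rule sum.reindex_bij_witness[of _ "\<lambda>x. x + 1" "\<lambda>x. x - 1"]) auto
  then have "of_nat CARD('k) = (0::'k)"
    by (simp add: sum.distrib)
  then show ?thesis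
    by (simp add: of_nat_eq_0_iff_char_dvd)
qed

text \<open>The multiplicative group of a finite field is cyclic. The subset \<open>L\<close> of a
  type is repackaged as an algebraic record to which this applies.\<close>

lemma finite_subfield_generator:
  fixes L :: "'a::field set"
  assumes fin: "finite L" and L: "0 \<in> L" "1 \<in> L" "\<And>x y. x \<in> L \<Longrightarrow> y \<in> L \<Longrightarrow> x + y \<in> L"
    "\<And>x y. x \<in> L \<Longrightarrow> y \<in> L \<Longrightarrow> x * y \<in> L" "\<And>x. x \<in> L \<Longrightarrow> - x \<in> L" "\<And>x. x \<in> L \<Longrightarrow> inverse x \<in> L"
  obtains g where "g \<in> L" "\<And>x. x \<in> L \<Longrightarrow> x \<noteq> 0 \<Longrightarrow> \<exists>i::nat. x = g ^ i"
proof -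
  define R :: "'a ring" where "R = \<lparr>carrier = L, mult = (*), one = 1, zero = 0, add = (+)\<rparr>"
  have "cring R"
  proof (rule cringI)
    show "abelian_group R"
      using L by (intro abelian_groupI) (auto simp: R_def algebra_simps intro!: bexI[of _ "- _"])
    show "comm_monoid R"
      using L by (intro comm_monoidI) (auto simp: R_def algebra_simps)
  qed (auto simp: R_def algebra_simps)
  then interpret cring R .
  have "x \<in> Units R" if "x \<in> L" "x \<noteq> 0" for x
    using that L by (auto simp: Units_def R_def intro!: bexI[of _ "inverse x"])
  then interpret field R
    by (intro cring_fieldI2) (auto simp: R_def Units_def)
  obtain g where g: "g \<in> carrier (mult_of R)" "carrier (mult_of R) = {g [^]\<^bsub>R\<^esub> i | i::nat. i \<in> UNIV}"
    using finite_field_mult_group_has_gen fin by (auto simp: R_def)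
  have pow: "x [^]\<^bsub>R\<^esub> (i::nat) = x ^ i" for x i
    by (induction i) (simp_all add: R_def nat_pow_def)
  show thesis
  proof (rule that)
    show "g \<in> L"
      using g(1) by (simp add: R_def)
    fix x assume "x \<in> L" "x \<noteq> 0"
    then have "x \<in> carrier (mult_of R)"
      by (simp add: R_def)
    then show "\<exists>i::nat. x = g ^ i"
      unfolding g(2) pow by blast
  qed
qed

text \<open>The condition \<open>card_char_power\<close> makes \<open>frob\<close> additive, by the
  freshman's dream.\<close>

locale finite_base_field =
  fixes k :: "'k::field itself"
  assumes fin: "finite (UNIV :: 'k set)"
    and card_char_power: "\<exists>e. CARD('k) = CHAR('k) ^ e"
begin

definition frob :: "'k alg_closure \<Rightarrow> 'k alg_closure" where
  "frob x = x ^ CARD('k)"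

lemma card_pos: "CARD('k) > 1"
proof -
  have "card {0, 1 :: 'k} \<le> CARD('k)"
    using fin by (intro card_mono) auto
  then show ?thesis
    by simp
qed

sublocale frob: type_ring_hom frob
proof
  fix x y
  obtain e where "CARD('k) = CHAR('k) ^ e"
    using card_char_power by blast
  moreover have "Factorial_Ring.prime CHAR('k)"
    using finite_imp_CHAR_pos[OF fin] by (rule prime_CHAR_semidom)
  ultimately show "frob (x + y) = frob x + frob y"
    unfolding frob_def by (intro freshmans_dream'[where n = e]) simp_all
qed (simp_all add: frob_def power_mult_distrib)

text \<open>The fixed points are the roots of \<open>X^q - X\<close>, where \<open>q\<close> is
  \<open>CARD('k)\<close>. There are at most \<open>q\<close> of them, and the \<open>q\<close>
  elements of the base field are among them.\<close>

lemma frob_eq_self_iff: "frob x = x \<longleftrightarrow> x \<in> range to_ac"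
proof -
  define p :: "'k alg_closure poly" where "p = Polynomial.monom 1 (CARD('k)) - Polynomial.monom 1 1"
  have "p \<noteq> 0"
    using card_pos by (metis p_def eq_iff_diff_eq_0 monom_eq_iff' less_irrefl zero_neq_one)
  have deg: "Polynomial.degree p \<le> CARD('k)"
    unfolding p_def using card_pos by (intro degree_diff_le order.trans[OF degree_monom_le]) auto
  have roots: "{x. poly p x = 0} = {x. frob x = x}"
    by (auto simp: p_def poly_monom frob_def)
  have sub: "range to_ac \<subseteq> {x. frob x = x}"
    using power_card_UNIV_eq[OF fin] by (auto simp: frob_def simp flip: to_ac_power)
  have "card {x. frob x = x} \<le> card (range (to_ac :: 'k \<Rightarrow> _))"
    using card_poly_roots_bound[OF \<open>p \<noteq> 0\<close>] deg by (simp add: roots card_image inj_to_ac)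
  moreover have "finite {x. frob x = x}"
    using poly_roots_finite[OF \<open>p \<noteq> 0\<close>] roots by simp
  ultimately have "range to_ac = {x. frob x = x}"
    using sub by (intro card_seteq)
  then show ?thesis
    by blast
qed

lemma frob_gal: "frob \<in> carrier gal"
proof -
  have "surj frob"
    using nth_root_exists[of "CARD('k)"] card_pos by (metis frob_def less_trans zero_less_one surjI)
  then show ?thesis
    using frob.hom_inj frob_eq_self_iff
    by (auto simp: galois_group_def bij_def frob.hom_add frob.hom_mult)
qed

lemma frob_pow_gal: "frob ^^ i \<in> carrier gal"
proof (induction i)
  case 0
  show ?case
    unfolding funpow.simps(1) by (rule gal_id)
next
  case (Suc i)
  then show ?case
    unfolding funpow.simps(2) by (intro gal_comp frob_gal)
qed

lemma frob_pow: "(frob ^^ i) x = x ^ (CARD('k) ^ i)"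
  by (induction i) (simp_all add: frob_def power_mult[symmetric] mult.commute)

lemma gal_poly_root:
  assumes "\<sigma> \<in> carrier gal" "poly (map_poly to_ac p) x = 0"
  shows "poly (map_poly to_ac p) (\<sigma> x) = 0"
proof -
  interpret \<sigma>: type_ring_hom \<sigma>
    using gal_hom[OF assms(1)] .
  have "map_poly \<sigma> (map_poly to_ac p) = map_poly to_ac p"
    by (rule poly_eqI) (simp add: coeff_map_poly \<sigma>.hom_zero gal_to_ac[OF assms(1)])
  then show ?thesis
    using \<sigma>.hom_poly[of "map_poly to_ac p" x] assms(2) by (simp add: \<sigma>.hom_zero)
qed

text \<open>The iterates of \<open>x\<close> are roots of one polynomial over the base, so two of
  them coincide, and injectivity of \<open>frob\<close> removes the preperiod.\<close>

lemma frob_periodic: "\<exists>n>0. (frob ^^ n) x = x"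
proof -
  obtain p :: "'k poly" where p: "p \<noteq> 0" "poly (map_poly to_ac p) x = 0"
    by (rule alg_closure_algebraic)
  have "finite {y. poly (map_poly to_ac p) y = 0}"
    using p(1) by (intro poly_roots_finite) (simp add: map_poly_eq_0_iff)
  moreover have "range (\<lambda>i. (frob ^^ i) x) \<subseteq> {y. poly (map_poly to_ac p) y = 0}"
    using gal_poly_root[OF frob_pow_gal p(2)] by blast
  ultimately have "\<not> inj (\<lambda>i. (frob ^^ i) x)"
    using infinite_UNIV_nat finite_imageD finite_subset by metis
  then obtain i j where "i \<noteq> j" "(frob ^^ i) x = (frob ^^ j) x"
    by (auto simp: inj_def)
  then obtain i j where ij: "i < j" "(frob ^^ i) x = (frob ^^ j) x"
    by (metis linorder_neqE_nat)
  have "(frob ^^ i) ((frob ^^ (j - i)) x) = (frob ^^ i) x"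
    using ij by (metis comp_apply funpow_add le_add_diff_inverse less_imp_le)
  then have "(frob ^^ (j - i)) x = x"
    using gal_bij[OF frob_pow_gal] by (meson bij_is_inj injD)
  then show ?thesis
    using ij by (intro exI[of _ "j - i"]) auto
qed

lemma frob_common_period:
  assumes "finite B"
  shows "\<exists>n>0. \<forall>x\<in>B. (frob ^^ n) x = x"
  using assms
proof (induction B rule: finite_induct)
  case empty
  then show ?case
    by auto
next
  case (insert b B)
  obtain n m where nm: "n > 0" "\<forall>x\<in>B. (frob ^^ n) x = x" "m > 0" "(frob ^^ m) b = b"
    using insert.IH frob_periodic by blast
  have iter: "(frob ^^ (i * j)) x = x" if "(frob ^^ i) x = x" for i j x
    using that by (induction j) (simp_all add: funpow_add)
  show ?case
    using nm iter[of m b n] iter[of n _ m]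
    by (intro exI[of _ "n * m"]) (auto simp: mult.commute)
qed

text \<open>The polynomial with roots \<open>x, frob x, frob\<^sup>2 x, \<dots>\<close> is fixed by \<open>frob\<close>, hence has coefficients in
  the base field.\<close>

lemma gal_eq_frob_pow:
  assumes \<sigma>: "\<sigma> \<in> carrier gal"
  shows "\<exists>i. \<sigma> x = (frob ^^ i) x"
proof -
  obtain n where n: "n > 0" "(frob ^^ n) x = x"
    using frob_periodic by blast
  define p where "p = (\<Prod>i<n. [:- (frob ^^ i) x, 1:])"
  have "map_poly frob p = (\<Prod>i<n. [:- (frob ^^ Suc i) x, 1:])"
    by (simp add: p_def frob.map_poly_hom_prod frob.map_poly_hom_linear)
  also have "\<dots> = p"
  proof -
    obtain m where m: "n = Suc m"
      using n(1) gr0_implies_Suc by blast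
    have "(\<Prod>i<n. [:- (frob ^^ Suc i) x, 1:]) = (\<Prod>i<m. [:- (frob ^^ Suc i) x, 1:]) * [:- x, 1:]"
      using n(2) unfolding m by (subst prod.lessThan_Suc) simp
    also have "\<dots> = p"
      unfolding p_def m by (subst prod.lessThan_Suc_shift) (simp del: funpow.simps(2))
    finally show ?thesis .
  qed
  finally have "frob (Polynomial.coeff p i) = Polynomial.coeff p i" for i
    by (metis coeff_map_poly frob.hom_zero)
  then have "Polynomial.coeff p i \<in> range to_ac" for i
    using frob_eq_self_iff by blast
  then have "map_poly to_ac (map_poly of_ac p) = p"
    by (intro poly_eqI) (simp add: coeff_map_poly to_ac_of_ac)
  moreover have "poly p x = 0"
    using n(1) by (auto simp: p_def poly_prod intro!: bexI[of _ 0])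
  ultimately have "poly p (\<sigma> x) = 0"
    using gal_poly_root[OF \<sigma>, of "map_poly of_ac p"] by simp
  then show ?thesis
    by (auto simp: p_def poly_prod)
qed

text \<open>All of \<open>B\<close> is fixed by one power of \<open>frob\<close>, so it lies in a
  finite subfield \<open>L\<close>. Nonzero elements of \<open>L\<close> are powers of one
  \<open>g\<close>, hence the exponent found for \<open>g\<close> serves the whole of
  \<open>B\<close>.\<close>

lemma gal_eq_frob_pow_on_finite:
  assumes \<sigma>: "\<sigma> \<in> carrier gal" and B: "finite B"
  shows "\<exists>i. \<forall>x\<in>B. (frob ^^ i) x = \<sigma> x"
proof -
  interpret \<sigma>: type_ring_hom \<sigma>
    using gal_hom[OF \<sigma>] .
  obtain n where n: "n > 0" "\<forall>x\<in>B. (frob ^^ n) x = x"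
    using frob_common_period[OF B] by blast
  interpret fn: type_ring_hom "frob ^^ n"
    using gal_hom[OF frob_pow_gal] .
  define L where "L = {x. (frob ^^ n) x = x}"
  have "finite L"
  proof -
    define p :: "'k alg_closure poly" where "p = Polynomial.monom 1 (CARD('k) ^ n) - Polynomial.monom 1 1"
    \<comment> \<open>This keeps the two monomials of \<open>p\<close> apart, so that
      \<open>p\<close> is nonzero and has finitely many roots.\<close>
    have "CARD('k) ^ n \<noteq> 1"
      using card_pos n(1) by auto
    then have "p \<noteq> 0"
      by (metis p_def eq_iff_diff_eq_0 monom_eq_iff' zero_neq_one)
    then show ?thesis
      using poly_roots_finite[of p] by (simp add: L_def p_def poly_monom frob_pow)
  qed
  then obtain g where g: "g \<in> L" "\<And>x. x \<in> L \<Longrightarrow> x \<noteq> 0 \<Longrightarrow> \<exists>i::nat. x = g ^ i"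
    by (rule finite_subfield_generator)
      (auto simp: L_def fn.hom_zero fn.hom_one fn.hom_add fn.hom_mult fn.hom_uminus fn.hom_inverse)
  obtain i where i: "\<sigma> g = (frob ^^ i) g"
    using gal_eq_frob_pow[OF \<sigma>] by blast
  interpret fi: type_ring_hom "frob ^^ i"
    using gal_hom[OF frob_pow_gal] .
  have "(frob ^^ i) x = \<sigma> x" if x: "x \<in> B" for x
  proof (cases "x = 0")
    case False
    then obtain j :: nat where "x = g ^ j"
      using g(2)[of x] n(2) x by (auto simp: L_def)
    then show ?thesis
      by (simp add: \<sigma>.hom_power fi.hom_power i)
  qed (simp add: \<sigma>.hom_zero fi.hom_zero)
  then show ?thesis
    by blast
qed

end

lemma finite_cocycles_finite_field:
  fixes P :: "'p monoid"
  assumes "finite_base_field TYPE('k::field)" and "group P" and finP: "finite (carrier P)"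
  shows "finite (cocycles gal (krull :: ('k alg_closure \<Rightarrow> 'k alg_closure) topology) P trivial_act)"
    (is "finite ?Z")
proof -
  interpret finite_base_field "TYPE('k)" by fact
  interpret P: group P by fact
  have "inj_on (\<lambda>c. c frob) ?Z"
  proof (rule inj_onI)
    fix c c' assume c: "c \<in> ?Z" and c': "c' \<in> ?Z" and eq: "c frob = c' frob"
    have mult: "b (\<sigma> \<circ> \<tau>) = b \<sigma> \<otimes>\<^bsub>P\<^esub> b \<tau>" if "b \<in> ?Z" "\<sigma> \<in> carrier gal" "\<tau> \<in> carrier gal" for b \<sigma> \<tau>
      using that by (simp add: cocycles_def trivial_act_def gal_mult)
    have mem: "b \<sigma> \<in> carrier P" if "b \<in> ?Z" "\<sigma> \<in> carrier gal" for b \<sigma>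
      using that by (auto simp: cocycles_def)
    have one: "b id = \<one>\<^bsub>P\<^esub>" if "b \<in> ?Z" for b
      using mult[OF that gal_id gal_id] mem[OF that gal_id] by simp
    have pow: "c (frob ^^ i) = c' (frob ^^ i)" for i
    proof (induction i)
      case 0
      show ?case
        unfolding funpow.simps(1) one[OF c] one[OF c'] ..
    next
      case (Suc i)
      then show ?case
        unfolding funpow.simps(2) by (simp only: mult[OF c] mult[OF c'] frob_gal frob_pow_gal eq)
    qed
    have "c \<sigma> = c' \<sigma>" if \<sigma>: "\<sigma> \<in> carrier gal" for \<sigma>
    proof -
      \<comment> \<open>On this open neighbourhood of \<open>\<sigma>\<close> both cocycles keep
        their value at \<open>\<sigma>\<close>. It contains a power of \<open>frob\<close>, where
        the two cocycles agree.\<close>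
      define U where "U = {\<tau> \<in> topspace krull. c \<tau> \<in> {c \<sigma>}} \<inter> {\<tau> \<in> topspace krull. c' \<tau> \<in> {c' \<sigma>}}"
      have "openin krull U"
        unfolding U_def using c c' mem[OF c \<sigma>] mem[OF c' \<sigma>]
        by (intro openin_Int openin_continuous_map_preimage[where Y = "discrete_topology (carrier P)"])
          (auto simp: cocycles_def)
      moreover have "\<sigma> \<in> U"
        using \<sigma> by (simp add: U_def topspace_krull)
      ultimately obtain B where B: "finite B" "\<forall>\<tau>\<in>carrier gal. (\<forall>x\<in>B. \<tau> x = \<sigma> x) \<longrightarrow> \<tau> \<in> U"
        using krull_open_nbhd by blast
      obtain i where "\<forall>x\<in>B. (frob ^^ i) x = \<sigma> x"
        using gal_eq_frob_pow_on_finite[OF \<sigma> B(1)] by blast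
      then have "frob ^^ i \<in> U"
        using B(2) frob_pow_gal by blast
      then show ?thesis
        using pow[of i] by (auto simp: U_def)
    qed
    then show "c = c'"
      using c c' by (intro PiE_ext[of c "carrier gal" "\<lambda>_. carrier P"]) (auto simp: cocycles_def)
  qed
  moreover have "(\<lambda>c. c frob) ` ?Z \<subseteq> carrier P"
    using frob_gal by (auto simp: cocycles_def)
  ultimately show ?thesis
    using finP finite_imageD finite_subset by blast
qed

lemma finite_H1_base_field:
  fixes P :: "'p monoid"
  assumes base_field:
      "(\<exists>f :: 'k::field \<Rightarrow> real. bij f \<and> (\<forall>x y. f (x + y) = f x + f y) \<and> (\<forall>x y. f (x * y) = f x * f y))
       \<or> (\<exists>p e :: nat. Factorial_Ring.prime p \<and> odd p \<and> e \<ge> 1 \<and> CARD('k) = p ^ e)"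
    and P: "group P" and finP: "finite (carrier P)"
  shows "finite (H1 gal (krull :: ('k alg_closure \<Rightarrow> 'k alg_closure) topology) P trivial_act)"
proof -
  let ?Z = "cocycles gal (krull :: ('k alg_closure \<Rightarrow> 'k alg_closure) topology) P trivial_act"
  have "finite ?Z"
    using base_field
  proof (elim disjE exE conjE)
    fix f :: "'k \<Rightarrow> real"
    assume "bij f" "\<forall>x y. f (x + y) = f x + f y" "\<forall>x y. f (x * y) = f x * f y"
    then have "finite (carrier (gal :: ('k alg_closure \<Rightarrow> 'k alg_closure) monoid))"
      by (intro finite_gal_real) auto
    then have "finite (carrier (gal :: ('k alg_closure \<Rightarrow> 'k alg_closure) monoid) \<rightarrow>\<^sub>E carrier P)"
      using finP by (intro finite_PiE) auto
    then show ?thesis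
      by (rule rev_finite_subset) (auto simp: cocycles_def)
  next
    fix p e :: nat
    assume p: "Factorial_Ring.prime p" and "e \<ge> 1" and card: "CARD('k) = p ^ e"
    \<comment> \<open>Infinite types have \<open>CARD\<close> zero, so a positive value yields
      finiteness.\<close>
    then have "CARD('k) > 0"
      by (simp add: prime_gt_0_nat)
    then have fin: "finite (UNIV :: 'k set)"
      by (simp add: card_gt_0_iff)
    have "Factorial_Ring.prime CHAR('k)"
      using finite_imp_CHAR_pos[OF fin] by (rule prime_CHAR_semidom)
    then have "CHAR('k) = p"
      using CHAR_dvd_CARD_field[OF fin] p card by (metis prime_dvd_power primes_dvd_imp_eq)
    then have "finite_base_field TYPE('k)"
      using fin card by unfold_locales auto
    then show ?thesis
      using P finP by (rule finite_cocycles_finite_field)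
  qed
  then show ?thesis
    by (simp add: H1_def quotient_def)
qed


section \<open>Galois conjugation of automorphisms\<close>

definition gal_vec :: "('a \<Rightarrow> 'a) \<Rightarrow> 'a ^ 'v \<Rightarrow> 'a ^ 'v::finite" where
  "gal_vec \<sigma> x = (\<chi> i. \<sigma> (x $ i))"

definition gal_mat :: "('a \<Rightarrow> 'a) \<Rightarrow> 'a ^ 'v ^ 'v \<Rightarrow> 'a ^ 'v ^ 'v::finite" where
  "gal_mat \<sigma> M = (\<chi> i j. \<sigma> (M $ i $ j))"

lemma gal_pt_eq: "gal_pt \<sigma> p = gal_vec \<sigma> ` p"
  by (simp add: gal_pt_def gal_vec_def)

context type_ring_hom
begin

lemma lookup_map_hom: "Poly_Mapping.lookup (Poly_Mapping.map f G) m = f (Poly_Mapping.lookup G m)"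
  by (simp add: Poly_Mapping.map.rep_eq when_def hom_zero)

lemma keys_map_hom: "Poly_Mapping.keys (Poly_Mapping.map f G) = Poly_Mapping.keys G"
  by (auto simp: in_keys_iff lookup_map_hom hom_eq_0_iff)

lemma homogeneous_map_hom: "homogeneous e (Poly_Mapping.map f G) \<longleftrightarrow> homogeneous e G"
  by (simp add: homogeneous_def keys_map_hom)

end

section \<open>Semilinear action on vectors, matrices and projective points\<close>

locale field_automorphism = type_ring_hom \<sigma> for \<sigma> :: "'a::field \<Rightarrow> 'a" +
  assumes bij: "bij \<sigma>"
begin

abbreviation "\<sigma>' \<equiv> inv_into UNIV \<sigma>"

lemma inv_simps [simp]: "\<sigma> (\<sigma>' x) = x" "\<sigma>' (\<sigma> x) = x"
  using bij by (simp_all add: bij_is_inj bij_is_surj surj_f_inv_f)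

lemma gal_vec_inv [simp]: "gal_vec \<sigma> (gal_vec \<sigma>' x) = x" "gal_vec \<sigma>' (gal_vec \<sigma> x) = x"
  by (simp_all add: gal_vec_def vec_eq_iff)

lemma gal_vec_eq_0_iff: "gal_vec \<sigma> x = 0 \<longleftrightarrow> x = 0"
  by (simp add: gal_vec_def vec_eq_iff hom_eq_0_iff)

lemma gal_pt_inv [simp]: "gal_pt \<sigma> (gal_pt \<sigma>' p) = p" "gal_pt \<sigma>' (gal_pt \<sigma> p) = p"
  by (simp_all add: gal_pt_eq image_image)

lemma gal_vec_scale: "gal_vec \<sigma> (c *s x) = \<sigma> c *s gal_vec \<sigma> x"
  by (simp add: gal_vec_def vec_eq_iff hom_mult)

lemma gal_vec_mult: "gal_vec \<sigma> (M *v x) = gal_mat \<sigma> M *v gal_vec \<sigma> x"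
  by (simp add: gal_vec_def gal_mat_def vec_eq_iff matrix_vector_mult_def hom_sum hom_mult)

text \<open>\<open>gal_vec \<sigma>\<close> is semilinear, so a line goes into a line. It fills that
  line because every scalar \<open>c\<close> is the image of \<open>\<sigma>' c\<close>.\<close>

lemma gal_pt_proj: "gal_pt \<sigma> (proj_pt x) = proj_pt (gal_vec \<sigma> x)"
proof
  show "gal_pt \<sigma> (proj_pt x) \<subseteq> proj_pt (gal_vec \<sigma> x)"
    using hom_eq_0_iff by (auto simp: gal_pt_eq proj_pt_def gal_vec_scale)
  show "proj_pt (gal_vec \<sigma> x) \<subseteq> gal_pt \<sigma> (proj_pt x)"
  proof
    fix y assume "y \<in> proj_pt (gal_vec \<sigma> x)"
    then obtain c where c: "c \<noteq> 0" "y = c *s gal_vec \<sigma> x"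
      by (auto simp: proj_pt_def)
    then have "y = gal_vec \<sigma> (\<sigma>' c *s x)" "\<sigma>' c \<noteq> 0"
      using hom_eq_0_iff[of "\<sigma>' c"] by (simp_all add: gal_vec_scale)
    then show "y \<in> gal_pt \<sigma> (proj_pt x)"
      by (auto simp: gal_pt_eq proj_pt_def)
  qed
qed

lemma mpol_eval_gal: "mpol_eval (Poly_Mapping.map \<sigma> G) (gal_vec \<sigma> x) = \<sigma> (mpol_eval G x)"
  by (simp add: mpol_eval_def keys_map_hom lookup_map_hom gal_vec_def hom_sum hom_mult hom_prod hom_power)

lemma mpol_map_gal: "mpol_map (\<lambda>i. Poly_Mapping.map \<sigma> (G i)) (gal_vec \<sigma> x) = gal_vec \<sigma> (mpol_map G x)"
  by (simp add: mpol_map_def mpol_eval_gal) (simp add: gal_vec_def)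

lemma gal_mat_mult: "gal_mat \<sigma> (M ** N) = gal_mat \<sigma> M ** gal_mat \<sigma> N"
  by (simp add: gal_mat_def vec_eq_iff matrix_matrix_mult_def hom_sum hom_mult)

lemma gal_mat_one: "gal_mat \<sigma> (mat 1) = mat 1"
  by (simp add: gal_mat_def vec_eq_iff mat_def hom_zero hom_one)

lemma invertible_gal_mat: "invertible M \<Longrightarrow> invertible (gal_mat \<sigma> M)"
  unfolding invertible_def by (metis gal_mat_mult gal_mat_one)

lemma gal_mat_perm: "gal_mat \<sigma> (perm_matrix p) = perm_matrix p"
  by (simp add: gal_mat_def perm_matrix_def vec_eq_iff hom_zero hom_one)

end

text \<open>Stability under both \<open>\<sigma>\<close> and its inverse makes
  \<open>gal_pt \<sigma>\<close> a permutation of \<open>V\<close>.\<close>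

locale galois_stable_variety = field_automorphism \<sigma> for \<sigma> :: "'a::field \<Rightarrow> 'a" +
  fixes V :: "('a ^ 'v::finite) set set"
  assumes stable: "p \<in> V \<Longrightarrow> gal_pt \<sigma> p \<in> V" and stable_inv: "p \<in> V \<Longrightarrow> gal_pt \<sigma>' p \<in> V"
begin

text \<open>Conjugating a matrix map by a semilinear bijection applies \<open>\<sigma>\<close> to
  the entries. Permutation matrices, with entries 0 and 1, are therefore fixed, and diagonal ones
  stay diagonal.\<close>

lemma gal_act_linear: "gal_act V \<sigma> (linear_map V M) = linear_map V (gal_mat \<sigma> M)"
proof
  fix p
  show "gal_act V \<sigma> (linear_map V M) p = linear_map V (gal_mat \<sigma> M) p"
    by (simp add: gal_act_def linear_map_def stable_inv gal_pt_eq[of _ "_ ` _"] image_image gal_vec_mult)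
      (simp add: gal_pt_eq image_image)
qed

lemma gal_act_perm: "gal_act V \<sigma> (perm_aut V p) = perm_aut V p"
  by (simp add: perm_aut_def gal_act_linear gal_mat_perm)

lemma gal_act_Bij:
  assumes "\<phi> \<in> Bij V"
  shows "gal_act V \<sigma> \<phi> \<in> Bij V"
proof -
  have "bij_betw \<phi> V V"
    using assms by (simp add: Bij_def)
  moreover have "bij_betw (gal_pt \<sigma>) V V"
    by (rule bij_betwI[where g = "gal_pt \<sigma>'"]) (simp_all add: stable stable_inv)
  moreover have "bij_betw (gal_pt \<sigma>') V V"
    by (rule bij_betwI[where g = "gal_pt \<sigma>"]) (simp_all add: stable stable_inv)
  ultimately have "bij_betw (gal_pt \<sigma> \<circ> (\<phi> \<circ> gal_pt \<sigma>')) V V"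
    by (intro bij_betw_trans)
  then have "bij_betw (gal_act V \<sigma> \<phi>) V V"
    by (rule bij_betw_cong[THEN iffD1, rotated]) (simp add: gal_act_def)
  then show ?thesis
    by (simp add: Bij_def gal_act_def)
qed

lemma gal_act_compose:
  assumes "\<psi> \<in> Bij V"
  shows "gal_act V \<sigma> (compose V \<phi> \<psi>) = compose V (gal_act V \<sigma> \<phi>) (gal_act V \<sigma> \<psi>)"
proof
  fix p
  have "\<psi> (gal_pt \<sigma>' p) \<in> V" if "p \<in> V"
    using assms that stable_inv Bij_imp_funcset by blast
  then show "gal_act V \<sigma> (compose V \<phi> \<psi>) p = compose V (gal_act V \<sigma> \<phi>) (gal_act V \<sigma> \<psi>) p"
    by (simp add: gal_act_def compose_def stable stable_inv)
qed

text \<open>Membership in \<open>aut_group\<close> also asks for a regular inverse; identified in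
  this form, the inverse falls under \<open>regular_gal_act\<close>.\<close>

lemma gal_act_inv_into:
  assumes "\<phi> \<in> Bij V"
  shows "(\<lambda>p\<in>V. inv_into V (gal_act V \<sigma> \<phi>) p) = gal_act V \<sigma> (\<lambda>p\<in>V. inv_into V \<phi> p)"
proof
  fix p
  show "(\<lambda>p\<in>V. inv_into V (gal_act V \<sigma> \<phi>) p) p = gal_act V \<sigma> (\<lambda>p\<in>V. inv_into V \<phi> p) p"
  proof (cases "p \<in> V")
    case True
    have inj: "inj_on (gal_act V \<sigma> \<phi>) V"
      using gal_act_Bij[OF assms] by (simp add: Bij_def bij_betw_def)
    have q: "inv_into V \<phi> (gal_pt \<sigma>' p) \<in> V" "\<phi> (inv_into V \<phi> (gal_pt \<sigma>' p)) = gal_pt \<sigma>' p"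
      using assms True stable_inv
      by (auto simp: Bij_def bij_betw_def inv_into_into f_inv_into_f)
    have "inv_into V (gal_act V \<sigma> \<phi>) p = gal_pt \<sigma> (inv_into V \<phi> (gal_pt \<sigma>' p))"
      using inj q True by (intro inv_into_f_eq) (simp_all add: gal_act_def stable)
    then show ?thesis
      using True by (simp add: gal_act_def stable_inv)
  qed (simp add: gal_act_def)
qed

text \<open>Around \<open>p\<close>, the conjugated map is given by the polynomials that represent
  \<open>\<phi>\<close> around the inverse translate of \<open>p\<close>, with
  \<open>\<sigma>\<close> applied to their coefficients.\<close>

lemma regular_gal_act:
  assumes "regular_map V \<phi>"
  shows "regular_map V (gal_act V \<sigma> \<phi>)"
  unfolding regular_map_def
proof
  fix p assume p: "p \<in> V"
  obtain e G where eG: "(\<forall>i. homogeneous e (G i)) \<and> (\<exists>x\<in>gal_pt \<sigma>' p. mpol_map G x \<noteq> 0) \<and>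
      (\<forall>q\<in>V. \<forall>y\<in>q. mpol_map G y \<noteq> 0 \<longrightarrow> \<phi> q = proj_pt (mpol_map G y))"
    using bspec[OF assms[unfolded regular_map_def] stable_inv[OF p]] by (elim exE)
  then have G: "\<forall>i. homogeneous e (G i)"
    and \<phi>: "\<And>q y. q \<in> V \<Longrightarrow> y \<in> q \<Longrightarrow> mpol_map G y \<noteq> 0 \<Longrightarrow> \<phi> q = proj_pt (mpol_map G y)"
    by simp_all
  obtain x where x: "x \<in> gal_pt \<sigma>' p" "mpol_map G x \<noteq> 0"
    using eG by (elim conjE bexE)
  define H where "H i = Poly_Mapping.map \<sigma> (G i)" for i
  have H: "mpol_map H (gal_vec \<sigma> y) = gal_vec \<sigma> (mpol_map G y)" for y
    unfolding H_def by (rule mpol_map_gal)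
  have "\<forall>i. homogeneous e (H i)"
    using G by (simp add: H_def homogeneous_map_hom)
  moreover have "gal_vec \<sigma> x \<in> p"
    using x(1) by (auto simp: gal_pt_eq)
  then have "\<exists>x\<in>p. mpol_map H x \<noteq> 0"
    using x(2) H gal_vec_eq_0_iff by metis
  moreover have "gal_act V \<sigma> \<phi> q = proj_pt (mpol_map H y)"
    if "q \<in> V" "y \<in> q" "mpol_map H y \<noteq> 0" for q y
  proof -
    have y': "gal_vec \<sigma>' y \<in> gal_pt \<sigma>' q" "mpol_map G (gal_vec \<sigma>' y) \<noteq> 0"
      using that H[of "gal_vec \<sigma>' y"] by (auto simp: gal_pt_eq gal_vec_eq_0_iff)
    have "gal_act V \<sigma> \<phi> q = gal_pt \<sigma> (proj_pt (mpol_map G (gal_vec \<sigma>' y)))"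
      using that \<phi>[OF stable_inv y'] by (simp add: gal_act_def)
    then show ?thesis
      using H[of "gal_vec \<sigma>' y"] by (simp add: gal_pt_proj)
  qed
  ultimately have "(\<forall>i. homogeneous e (H i)) \<and> (\<exists>x\<in>p. mpol_map H x \<noteq> 0) \<and>
      (\<forall>q\<in>V. \<forall>y\<in>q. mpol_map H y \<noteq> 0 \<longrightarrow> gal_act V \<sigma> \<phi> q = proj_pt (mpol_map H y))"
    by simp
  then show "\<exists>e G. (\<forall>i. homogeneous e (G i)) \<and> (\<exists>x\<in>p. mpol_map G x \<noteq> 0) \<and>
      (\<forall>q\<in>V. \<forall>y\<in>q. mpol_map G y \<noteq> 0 \<longrightarrow> gal_act V \<sigma> \<phi> q = proj_pt (mpol_map G y))"
    by (intro exI)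
qed

lemma gal_act_hom: "gal_act V \<sigma> \<in> hom (aut_group V) (aut_group V)"
  by (auto simp: hom_def aut_group_def BijGroup_def gal_act_Bij gal_act_compose gal_act_inv_into
      intro: regular_gal_act)

lemma gal_act_diag:
  assumes "\<phi> \<in> diag_auts V"
  shows "gal_act V \<sigma> \<phi> \<in> diag_auts V"
proof -
  obtain M :: "'a ^ 'v ^ 'v" where M: "invertible M" "\<forall>i j. i \<noteq> j \<longrightarrow> M $ i $ j = 0" "\<phi> = linear_map V M"
    and \<phi>: "\<phi> \<in> carrier (aut_group V)"
    using assms by (auto simp: diag_auts_def)
  have "gal_act V \<sigma> \<phi> \<in> carrier (aut_group V)"
    using gal_act_hom \<phi> by (auto simp: hom_def)
  moreover have "\<forall>i j. i \<noteq> j \<longrightarrow> gal_mat \<sigma> M $ i $ j = 0"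
    using M(2) by (simp add: gal_mat_def hom_zero)
  ultimately show ?thesis
    using M invertible_gal_mat gal_act_linear by (auto simp: diag_auts_def intro!: exI[of _ "gal_mat \<sigma> M"])
qed

end

text \<open>The equation has coefficients in the base field and is fixed by \<open>\<sigma>\<close>,
  so zeros go to zeros.\<close>

lemma gal_hypersurface_subset:
  assumes \<sigma>: "\<sigma> \<in> carrier gal" and p: "p \<in> hypersurface (base_change F)"
  shows "gal_pt \<sigma> p \<in> hypersurface (base_change F)"
proof -
  interpret field_automorphism \<sigma>
    using gal_hom[OF \<sigma>] gal_bij[OF \<sigma>] by (intro field_automorphism.intro field_automorphism_axioms.intro)
  have "Poly_Mapping.map \<sigma> (base_change F) = base_change F"
    by (rule poly_mapping_eqI)
      (simp add: lookup_map_hom base_change_def type_ring_hom.lookup_map_hom[OF to_ac_hom] gal_to_ac[OF \<sigma>])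
  then have "mpol_eval (base_change F) (gal_vec \<sigma> x) = \<sigma> (mpol_eval (base_change F) x)" for x
    using mpol_eval_gal[of "base_change F" x] by simp
  moreover obtain x where "p = proj_pt x" "x \<noteq> 0" "mpol_eval (base_change F) x = 0"
    using p by (auto simp: hypersurface_def)
  ultimately show ?thesis
    using gal_vec_eq_0_iff hom_zero
    by (auto simp: hypersurface_def gal_pt_proj intro!: exI[of _ "gal_vec \<sigma> x"])
qed

lemma galois_stable_hypersurface:
  assumes \<sigma>: "\<sigma> \<in> carrier gal"
  shows "galois_stable_variety \<sigma> (hypersurface (base_change F))"
proof -
  interpret field_automorphism \<sigma>
    using gal_hom[OF \<sigma>] gal_bij[OF \<sigma>] by (intro field_automorphism.intro field_automorphism_axioms.intro)
  show ?thesis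
    by unfold_locales (auto intro: gal_hypersurface_subset \<sigma> gal_inv)
qed

lemma group_perm_group: "group (perm_group F)"
proof -
  let ?K = "Poly_Mapping.keys F"
  let ?S = "{p. bij p \<and> (\<lambda>m. m \<circ> p) ` ?K = ?K}"
  interpret B: group "BijGroup (UNIV :: 'a set)"
    by (rule group_BijGroup)
  have BijU: "Bij (UNIV :: 'a set) = {p. bij p}"
    by (auto simp: Bij_def)
  have "subgroup ?S (BijGroup UNIV)"
  proof (rule B.subgroupI)
    show "?S \<subseteq> carrier (BijGroup UNIV)"
      by (auto simp: BijGroup_def BijU)
    have "id \<in> ?S"
      by simp
    then show "?S \<noteq> {}"
      by blast
    fix p assume p: "p \<in> ?S"
    then have bij: "bij p" and K: "(\<lambda>m. m \<circ> p) ` ?K = ?K"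
      by simp_all
    have pi: "p \<circ> inv_into UNIV p = id"
      using bij_is_surj[OF bij] by (simp only: surj_iff)
    have "(\<lambda>m. m \<circ> inv_into UNIV p) ` ?K = (\<lambda>m. m \<circ> inv_into UNIV p) ` (\<lambda>m. m \<circ> p) ` ?K"
      by (simp only: K)
    also have "\<dots> = (\<lambda>m. m \<circ> (p \<circ> inv_into UNIV p)) ` ?K"
      by (simp only: image_image comp_assoc)
    also have "\<dots> = ?K"
      by (simp only: pi comp_id image_ident)
    finally have inv: "(\<lambda>m. m \<circ> inv_into UNIV p) ` ?K = ?K" .
    have "inv_into UNIV p \<in> ?S"
      by (intro CollectI conjI bij_imp_bij_inv bij inv)
    moreover have "inv\<^bsub>BijGroup UNIV\<^esub> p = inv_into UNIV p"
      using p by (simp add: inv_BijGroup BijU restrict_def)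
    ultimately show "inv\<^bsub>BijGroup UNIV\<^esub> p \<in> ?S"
      by (simp only:)
    fix q assume q: "q \<in> ?S"
    then have bij': "bij q" and K': "(\<lambda>m. m \<circ> q) ` ?K = ?K"
      by simp_all
    have "(\<lambda>m. m \<circ> (p \<circ> q)) ` ?K = (\<lambda>m. m \<circ> q) ` (\<lambda>m. m \<circ> p) ` ?K"
      by (simp only: image_image comp_assoc)
    then have mult: "(\<lambda>m. m \<circ> (p \<circ> q)) ` ?K = ?K"
      by (simp only: K K')
    have "p \<circ> q \<in> ?S"
      by (intro CollectI conjI bij_comp bij bij' mult)
    moreover have "p \<otimes>\<^bsub>BijGroup UNIV\<^esub> q = p \<circ> q"
      using p q by (simp add: BijGroup_def BijU compose_def restrict_def comp_def)
    ultimately show "p \<otimes>\<^bsub>BijGroup UNIV\<^esub> q \<in> ?S"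
      by (simp only:)
  qed
  then show ?thesis
    unfolding perm_group_def by (rule B.subgroup_imp_group)
qed


text \<open>The twisted action depends on a cocycle and not only on its class, so the sum is formed
  with representatives \<open>rep C\<close>; the equality is claimed for every choice of
  them.\<close>

theorem theorem1:
  fixes F :: "('v::finite, 'k::field) mpol"
    and n d :: nat
    and rep :: "(('k alg_closure \<Rightarrow> 'k alg_closure) \<Rightarrow> 'v \<Rightarrow> 'v) set
                 \<Rightarrow> ('k alg_closure \<Rightarrow> 'k alg_closure) \<Rightarrow> 'v \<Rightarrow> 'v"
  defines "\<Gamma> \<equiv> galois_group (to_ac :: 'k \<Rightarrow> 'k alg_closure)"
    and "T \<equiv> krull_topology (to_ac :: 'k \<Rightarrow> 'k alg_closure)"
    and "V \<equiv> hypersurface (base_change F)"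
    and "P \<equiv> perm_group F"
  assumes base_field:
      "(\<exists>f :: 'k \<Rightarrow> real. bij f \<and> (\<forall>x y. f (x + y) = f x + f y) \<and> (\<forall>x y. f (x * y) = f x * f y))
       \<or> (\<exists>p e :: nat. Factorial_Ring.prime p \<and> odd p \<and> e \<ge> 1 \<and> CARD('k) = p ^ e)"
    and dim: "CARD('v) = n + 2" "n \<ge> 1"
    and deg: "homogeneous d F" "d \<ge> 3"
    and exceptions: "(n, d) \<notin> {(1, 3), (2, 4)}"
    and smooth: "smooth_hypersurface (base_change F)"
    and coeffs: "\<forall>m\<in>Poly_Mapping.keys F. Poly_Mapping.lookup F m = 1"
    and semidirect: "semidirect (aut_group V) (diag_auts V) P (perm_aut V)"
    and rep: "\<forall>C\<in>H1 \<Gamma> T P trivial_act. rep C \<in> C"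
  shows "ecard (H1 \<Gamma> T (aut_group V) (gal_act V)) =
    (\<Sum>C\<in>H1 \<Gamma> T P trivial_act.
      ecard (twisted_H1_orbits \<Gamma> T (aut_group V) (gal_act V) (diag_auts V) P (perm_aut V) (rep C)))"
proof -
  have \<Gamma>: "\<Gamma> = gal" and T: "T = krull"
    by (simp_all add: \<Gamma>_def T_def)
  have P: "group P"
    unfolding P_def by (rule group_perm_group)
  have stable: "galois_stable_variety \<sigma> V" if "\<sigma> \<in> carrier \<Gamma>" for \<sigma>
    using that unfolding \<Gamma> V_def by (rule galois_stable_hypersurface)
  interpret semidirect_with_action \<Gamma> T "aut_group V" "gal_act V" "diag_auts V" P "perm_aut V"
  proof (rule semidirect_with_action.intro)
    show "x \<otimes>\<^bsub>\<Gamma>\<^esub> y \<in> carrier \<Gamma>" if "x \<in> carrier \<Gamma>" "y \<in> carrier \<Gamma>" for x y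
      using that unfolding \<Gamma> gal_mult by (rule gal_comp)
    show "topspace T \<subseteq> carrier \<Gamma>"
      by (simp add: \<Gamma> T topspace_krull)
    show "group P"
      by (rule P)
    show "semidirect (aut_group V) (diag_auts V) P (perm_aut V)"
      by (rule semidirect)
    fix \<sigma> assume \<sigma>: "\<sigma> \<in> carrier \<Gamma>"
    show "gal_act V \<sigma> \<in> hom (aut_group V) (aut_group V)"
      by (rule galois_stable_variety.gal_act_hom[OF stable[OF \<sigma>]])
    show "gal_act V \<sigma> \<phi> \<in> diag_auts V" if "\<phi> \<in> diag_auts V" for \<phi>
      using that by (rule galois_stable_variety.gal_act_diag[OF stable[OF \<sigma>]])
    show "gal_act V \<sigma> (perm_aut V p) = perm_aut V p" for p
      by (rule galois_stable_variety.gal_act_perm[OF stable[OF \<sigma>]])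
  qed
  \<comment> \<open>Finiteness of \<open>P\<close> is immediate, as its elements are self-maps of
    the finite type \<open>'v\<close>.\<close>
  have "finite (H1 \<Gamma> T P trivial_act)"
    unfolding \<Gamma> T using base_field P by (rule finite_H1_base_field) simp
  then show ?thesis
    using rep by (rule ecard_H1_semidirect)
qed

end
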